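(* Let $T$ be a finite tree. Consider the following procedure, which places cops on vertices of $T$: (1) choose an arbitrary root $r$ of $T$; (2) among all unguarded leaves of $T$, choose one, $v$, at maximum distance from $r$; (3) if $v=r$ or $v$ is adjacent to $r$, place a cop at $r$; otherwise place a cop at the grandparent of $v$ (the vertex at distance 2 from $v$ on the path from $v$ to $r$); (4) repeat steps (2) and (3) until every leaf of $T$ is guarded. Here a leaf is guarded if some already placed cop is at distance at most 2 from it, and unguarded otherwise. If $N$ denotes the number of cops placed by this procedure, then $c_b(T)=N$. Moreover, the procedure can be executed in time polynomial in the number of vertices of $T$.
   Context: Bridge-burning Cops and Robbers is played on a finite graph $G$ by a team of cops and a single robber, with full information. First each cop chooses a starting vertex (several cops may share a vertex), then the robber chooses a starting vertex. The game then proceeds in rounds; in each round, first every cop either stays put or moves along an edge of the current graph to an adjacent vertex, and then the robber either stays put or moves along an edge of the current graph. Every edge traversed by the robber is immediately deleted from the graph (cop moves delete nothing). The cops win if at some moment some cop occupies the same vertex as the robber; the robber wins if he avoids this forever. $c_b(G)$ is the minimum number of cops for which the cops have a winning strategy. A leaf of $T$ is a vertex of degree at most 1 in $T$ (the root may be a leaf). *)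

theory Defs
  imports "Graph_Theory.Graph_Theory" "HOL-Computational_Algebra.Polynomial"
begin

section \<open>Finite trees\<close>

text \<open>
  A finite simple graph is a \<^locale>\<open>pair_graph\<close>: finite, loop-free and symmetric, an undirected
  edge \<open>uv\<close> being the two arcs \<open>(u, v)\<close> and \<open>(v, u)\<close>.  The library constant
  \<^const>\<open>tree\<close> is about directed cycles, so that already \<open>u, v, u\<close> is a cycle for it; undirected
  cycles are the directed ones of length at least 3.
\<close>

definition finite_tree :: "'a pair_pre_digraph \<Rightarrow> bool" where
  "finite_tree T \<longleftrightarrow> pair_graph T \<and> connected (with_proj T) \<and>
     \<not> (\<exists>p. pre_digraph.cycle (with_proj T) p \<and> length p \<ge> 3)"

definition gdist :: "'a pair_pre_digraph \<Rightarrow> 'a \<Rightarrow> 'a \<Rightarrow> nat" where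
  "gdist T u v = (LEAST k. \<exists>p. pre_digraph.awalk (with_proj T) u p v \<and> length p = k)"

definition leaves :: "'a pair_pre_digraph \<Rightarrow> 'a set" where
  "leaves T = {v \<in> pverts T. out_degree (with_proj T) v \<le> 1}"


section \<open>Bridge-burning Cops and Robbers\<close>

text \<open>
  A play is determined by the cops' strategy and by the trajectory \<open>x\<close> of the robber, \<open>x 0\<close> being
  his starting vertex and \<open>x t\<close> his position after round \<open>t\<close>.  \<open>remaining G x t\<close> is the graph after
  round \<open>t\<close>.
\<close>

definition remaining :: "'a pair_pre_digraph \<Rightarrow> (nat \<Rightarrow> 'a) \<Rightarrow> nat \<Rightarrow> 'a pair_pre_digraph" where
  "remaining G x t =
     G\<lparr>parcs := parcs G - (\<Union>s<t. {(x s, x (Suc s)), (x (Suc s), x s)})\<rparr>"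

definition may_move :: "'a pair_pre_digraph \<Rightarrow> 'a \<Rightarrow> 'a \<Rightarrow> bool" where
  "may_move G u v \<longleftrightarrow> v = u \<or> (u, v) \<in> parcs G"

definition robber_trajectory :: "'a pair_pre_digraph \<Rightarrow> (nat \<Rightarrow> 'a) \<Rightarrow> bool" where
  "robber_trajectory G x \<longleftrightarrow>
     x 0 \<in> pverts G \<and> (\<forall>t. may_move (remaining G x t) (x t) (x (Suc t)))"

text \<open>
  A cop strategy maps the robber's past positions to the list of the cops' next positions:
  \<open>\<sigma> []\<close> is the initial placement, and \<open>\<sigma> [x 0, \<dots>, x t]\<close> are the positions after the
  cops' move in round \<open>t + 1\<close>.
\<close>

type_synonym 'a cop_strategy = "'a list \<Rightarrow> 'a list"

definition cops_at :: "'a cop_strategy \<Rightarrow> (nat \<Rightarrow> 'a) \<Rightarrow> nat \<Rightarrow> 'a list" where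
  "cops_at \<sigma> x t = \<sigma> (map x [0..<t])"

definition legal_cop_strategy :: "'a pair_pre_digraph \<Rightarrow> nat \<Rightarrow> 'a cop_strategy \<Rightarrow> bool" where
  "legal_cop_strategy G k \<sigma> \<longleftrightarrow>
     length (\<sigma> []) = k \<and> set (\<sigma> []) \<subseteq> pverts G \<and>
     (\<forall>x t. robber_trajectory G x \<longrightarrow>
        list_all2 (may_move (remaining G x t)) (cops_at \<sigma> x t) (cops_at \<sigma> x (Suc t)))"

text \<open>
  In round \<open>t + 1\<close> the cops move while the robber is still at \<open>x t\<close>, so he can be caught there by
  \<open>cops_at \<sigma> x (Suc t)\<close>, or by \<open>cops_at \<sigma> x t\<close> if he has run into a cop.  A trajectory goes on
  formally after the capture; this is harmless, since the cops may then stay put.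
\<close>

definition captured :: "'a cop_strategy \<Rightarrow> (nat \<Rightarrow> 'a) \<Rightarrow> bool" where
  "captured \<sigma> x \<longleftrightarrow> (\<exists>t. x t \<in> set (cops_at \<sigma> x t) \<or> x t \<in> set (cops_at \<sigma> x (Suc t)))"

definition cops_win :: "'a pair_pre_digraph \<Rightarrow> nat \<Rightarrow> bool" where
  "cops_win G k \<longleftrightarrow>
     (\<exists>\<sigma>. legal_cop_strategy G k \<sigma> \<and> (\<forall>x. robber_trajectory G x \<longrightarrow> captured \<sigma> x))"

definition bridge_burning_cop_number :: "'a pair_pre_digraph \<Rightarrow> nat" where
  "bridge_burning_cop_number G = (LEAST k. cops_win G k)"


section \<open>The placement procedure\<close>

definition unguarded_leaves :: "'a pair_pre_digraph \<Rightarrow> 'a list \<Rightarrow> 'a set" where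
  "unguarded_leaves T cs = {v \<in> leaves T. \<not> (\<exists>c \<in> set cs. gdist T c v \<le> 2)}"

definition grandparent :: "'a pair_pre_digraph \<Rightarrow> 'a \<Rightarrow> 'a \<Rightarrow> 'a \<Rightarrow> bool" where
  "grandparent T r v g \<longleftrightarrow>
     (\<exists>p. pre_digraph.apath (with_proj T) v p r \<and> g \<in> set (pawalk_verts v p) \<and> gdist T v g = 2)"

definition cop_site :: "'a pair_pre_digraph \<Rightarrow> 'a \<Rightarrow> 'a \<Rightarrow> 'a \<Rightarrow> bool" where
  "cop_site T r v c \<longleftrightarrow>
     (if v = r \<or> (v, r) \<in> parcs T then c = r else grandparent T r v c)"

text \<open>
  The list \<open>cs\<close> holds the cops placed so far.  The relation leaves open which of several
  farthest unguarded leaves is taken.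
\<close>

definition placement_step :: "'a pair_pre_digraph \<Rightarrow> 'a \<Rightarrow> 'a list \<Rightarrow> 'a list \<Rightarrow> bool" where
  "placement_step T r cs cs' \<longleftrightarrow>
     (\<exists>v \<in> unguarded_leaves T cs. (\<forall>u \<in> unguarded_leaves T cs. gdist T u r \<le> gdist T v r) \<and>
        (\<exists>c. cop_site T r v c \<and> cs' = cs @ [c]))"

definition placement_result :: "'a pair_pre_digraph \<Rightarrow> 'a \<Rightarrow> 'a list \<Rightarrow> bool" where
  "placement_result T r cs \<longleftrightarrow> (placement_step T r)\<^sup>*\<^sup>* [] cs \<and> unguarded_leaves T cs = {}"


section \<open>A machine model for running time\<close>

text \<open>
  While programs over finitely many arrays of natural numbers, with indirect addressing.  This is
  a unit-cost random access machine whose only arithmetic operations are addition and truncated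
  subtraction, hence polynomially equivalent to a Turing machine: in \<open>t\<close> steps the bit length of
  the numbers grows by at most \<open>O(t)\<close>.  Every evaluated expression node and every executed command
  is charged.  \<open>Cell a i\<close> is the content of cell \<open>i\<close> of the array \<open>a\<close>.
\<close>

type_synonym store = "string \<Rightarrow> nat \<Rightarrow> nat"

datatype expr = Num nat | Cell string expr | Plus expr expr | Minus expr expr

datatype prog =
    Skip
  | Assign string expr expr
  | Seq prog prog
  | IfLess expr expr prog prog
  | WhileLess expr expr prog

primrec val :: "store \<Rightarrow> expr \<Rightarrow> nat" where
  "val s (Num n) = n"
| "val s (Cell a e) = s a (val s e)"
| "val s (Plus e f) = val s e + val s f"
| "val s (Minus e f) = val s e - val s f"

primrec cost :: "expr \<Rightarrow> nat" where
  "cost (Num n) = 1"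
| "cost (Cell a e) = cost e + 1"
| "cost (Plus e f) = cost e + cost f + 1"
| "cost (Minus e f) = cost e + cost f + 1"

definition update :: "store \<Rightarrow> string \<Rightarrow> nat \<Rightarrow> nat \<Rightarrow> store" where
  "update s a i n = s(a := (s a)(i := n))"

text \<open>\<open>exec P s t s'\<close>: started in \<open>s\<close>, the program \<open>P\<close> halts in \<open>s'\<close> after \<open>t\<close> steps.\<close>

inductive exec :: "prog \<Rightarrow> store \<Rightarrow> nat \<Rightarrow> store \<Rightarrow> bool" where
  Skip: "exec Skip s 1 s"
| Assign: "exec (Assign a e f) s (cost e + cost f + 1) (update s a (val s e) (val s f))"
| Seq: "exec P s t s' \<Longrightarrow> exec Q s' u s'' \<Longrightarrow> exec (Seq P Q) s (t + u + 1) s''"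
| IfTrue: "val s e < val s f \<Longrightarrow> exec P s t s' \<Longrightarrow>
    exec (IfLess e f P Q) s (cost e + cost f + t + 1) s'"
| IfFalse: "\<not> val s e < val s f \<Longrightarrow> exec Q s t s' \<Longrightarrow>
    exec (IfLess e f P Q) s (cost e + cost f + t + 1) s'"
| WhileFalse: "\<not> val s e < val s f \<Longrightarrow>
    exec (WhileLess e f P) s (cost e + cost f + 1) s"
| WhileTrue: "val s e < val s f \<Longrightarrow> exec P s t s' \<Longrightarrow> exec (WhileLess e f P) s' u s'' \<Longrightarrow>
    exec (WhileLess e f P) s (cost e + cost f + t + u + 1) s''"

text \<open>
  Input: a tree on the vertices \<open>0, \<dots>, n - 1\<close> as a list of its \<open>m\<close> edges, in any order and
  orientation and without repetition, together with the chosen root.  All cells that do not hold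
  input are 0 initially.
\<close>

definition input_store :: "nat \<Rightarrow> (nat \<times> nat) list \<Rightarrow> nat \<Rightarrow> store" where
  "input_store n es r = (\<lambda>a i.
     if a = ''n'' \<and> i = 0 then n
     else if a = ''m'' \<and> i = 0 then length es
     else if a = ''root'' \<and> i = 0 then r
     else if a = ''src'' \<and> i < length es then fst (es ! i)
     else if a = ''dst'' \<and> i < length es then snd (es ! i)
     else 0)"

definition represents :: "nat \<Rightarrow> (nat \<times> nat) list \<Rightarrow> nat pair_pre_digraph \<Rightarrow> bool" where
  "represents n es T \<longleftrightarrow>
     pverts T = {..<n} \<and> parcs T = set es \<union> (set es)\<inverse> \<and>
     distinct es \<and> set es \<inter> (set es)\<inverse> = {}"

definition output_cops :: "store \<Rightarrow> nat list" where
  "output_cops s = map (s ''cop'') [0..<s ''count'' 0]"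

end

(*
  In a tree the cops win if and only if every leaf has a cop within distance 2 at the start.  If a leaf
  has none, the robber starts at its neighbour and steps onto the leaf, which burns its only edge.
  Otherwise all cops walk towards the robber: after their first move every path from the robber to a leaf
  contains a cop, and this persists, because a burnt edge cuts the robber off from everything behind him.
  The robber moves finitely often, and while he rests a blocking cop comes closer.

  Let the procedure serve the leaf v with the cop c.  A leaf u that is still unguarded afterwards has
  distance at least 3 from c and is no farther from the root than v, and the four-point condition of the
  tree metric for v, c, u and the root gives d(u,v) >= 5.  So no vertex is within distance 2 of two of the
  leaves served, and no smaller number of cops suffices.

  Distances are computed by relaxation along the edges.  Since subtraction is truncated, the program
  stores n - d(root,u) and the maximum of 3 - d(c,u) over the cops c, so that missing values are 0.
*)

theory Submission
  imports Defs "HOL-Library.Sublist"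
begin

section \<open>The tree metric\<close>

locale undirected_tree =
  fixes T :: "'a pair_pre_digraph"
  assumes finite_tree: "finite_tree T"

sublocale undirected_tree \<subseteq> pair_graph T
  using finite_tree by (simp add: finite_tree_def)

context undirected_tree
begin

lemma cycle_length: "cycle p \<Longrightarrow> length p < 3"
  using finite_tree by (auto simp: finite_tree_def)

lemma apath_exists:
  assumes "u \<in> pverts T" "v \<in> pverts T"
  shows "\<exists>p. apath u p v"
proof -
  have "connected (with_proj T)"
    using finite_tree by (simp add: finite_tree_def)
  then have "strongly_connected (with_proj T)"
    by (rule symmetric_connected_imp_strongly_connected[OF sym_arcs])
  then have "u \<rightarrow>\<^sup>*\<^bsub>with_proj T\<^esub> v"
    using assms by (auto simp: strongly_connected_def)
  then show ?thesis
    by (simp add: reachable_apath)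
qed

lemma apath_snoc:
  assumes "apath x p z" "(z, w) \<in> parcs T" "w \<notin> set (pawalk_verts x p)"
  shows "apath x (p @ [(z, w)]) w"
proof -
  have "last (pawalk_verts x p) = z"
    using assms(1) by (auto simp: apath_def)
  then show ?thesis
    using assms in_arcsD2[OF assms(2)] no_loops'[OF assms(2)]
    by (auto simp: apath_append_iff apath_simps)
qed

lemma apath_snocE:
  assumes "apath x (q @ [e]) z"
  obtains b where "e = (b, z)" "(b, z) \<in> parcs T" "apath x q b" "z \<notin> set (pawalk_verts x q)"
proof -
  obtain b c where bc: "e = (b, c)"
    by (cases e)
  have e: "apath (last (pawalk_verts x q)) [e] z"
    and q: "apath x q (last (pawalk_verts x q))"
      "set (pawalk_verts x q) \<inter> set (tl (pawalk_verts (last (pawalk_verts x q)) [e])) = {}"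
    using assms by (simp_all add: apath_append_iff)
  have "(b, c) \<in> parcs T" and b: "last (pawalk_verts x q) = b" and c: "c = z"
    using e bc by (auto simp: apath_simps)
  then show ?thesis
    using that[of b] bc q unfolding b c by simp
qed

lemma apath_neighbor_on_path:
  assumes p: "apath x p z" and e: "(z, w) \<in> parcs T" and w: "w \<in> set (pawalk_verts x p)"
  shows "\<exists>q. p = q @ [(w, z)] \<and> apath x q w"
proof -
  obtain q s where qs: "p = q @ s" "awalk x q w" "awalk w s z"
    using awalk_decomp[OF awalkI_apath[OF p] w] by auto
  then have "apath x q w" "apath w s z"
    using p by (auto simp: apath_append_iff)
  have "s \<noteq> []"
    using \<open>apath w s z\<close> no_loops'[OF e] by (auto simp: apath_Nil_iff)
  have cyc: "awalk w (s @ [(z, w)]) w"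
    using awalk_appendI[of w s z "[(z, w)]" w] \<open>awalk w s z\<close> e in_arcsD2[OF e]
    by (simp add: awalk_simps del: awalk_append_iff)
  have "last (pawalk_verts w s) = z"
    using \<open>awalk w s z\<close> by auto
  then have "tl (pawalk_verts w (s @ [(z, w)])) = tl (pawalk_verts w s) @ [w]"
    using awalk_verts_append[OF cyc] by (cases s) auto
  moreover have "distinct (pawalk_verts w s)" "hd (pawalk_verts w s) = w"
    using \<open>apath w s z\<close> by (auto simp: apath_def)
  then have "distinct (tl (pawalk_verts w s) @ [w])"
    by (cases "pawalk_verts w s") auto
  ultimately have "cycle (s @ [(z, w)])"
    using cyc by (auto simp: cycle_def)
  then have "length s = 1"
    using cycle_length[of "s @ [(z, w)]"] \<open>s \<noteq> []\<close> by (cases s) auto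
  then have "s = [(w, z)]"
    using \<open>awalk w s z\<close> by (cases s) (auto simp: awalk_simps)
  with \<open>apath x q w\<close> qs show ?thesis by auto
qed

lemma apath_unique:
  assumes "apath x p z" "apath x q z"
  shows "p = q"
  using assms
proof (induction q arbitrary: p z rule: rev_induct)
  case Nil
  then have "x = z"
    by (simp add: apath_Nil_iff)
  then show ?case
    using apath_nonempty_ends[OF Nil.prems(1)] by blast
next
  case (snoc e q)
  obtain b where b: "e = (b, z)" "(b, z) \<in> parcs T" "apath x q b" "z \<notin> set (pawalk_verts x q)"
    using snoc.prems(2) by (rule apath_snocE)
  then have zb: "(z, b) \<in> parcs T"
    by (simp add: arcs_symmetric)
  show ?case
  proof (cases "b \<in> set (pawalk_verts x p)")
    case True
    then obtain q' where q': "p = q' @ [(b, z)]" "apath x q' b"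
      using apath_neighbor_on_path[OF snoc.prems(1) zb] by blast
    then show ?thesis
      using snoc.IH[OF q'(2) b(3)] b(1) by simp
  next
    case False
    then have "p @ [(z, b)] = q"
      using snoc.IH[OF apath_snoc[OF snoc.prems(1) zb] b(3)] by simp
    then have "(z, b) \<in> set q" by auto
    then have "z \<in> set (pawalk_verts x q)"
      using awalk_verts_arc1[of "(z, b)" q x] by simp
    with b show ?thesis by simp
  qed
qed

definition tpath :: "'a \<Rightarrow> 'a \<Rightarrow> ('a \<times> 'a) list" where
  "tpath u v = (THE p. apath u p v)"

lemma apath_iff_tpath:
  assumes "u \<in> pverts T" "v \<in> pverts T"
  shows "apath u p v \<longleftrightarrow> p = tpath u v"
proof -
  obtain q where q: "apath u q v"
    using apath_exists[OF assms] by auto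
  then have "tpath u v = q"
    unfolding tpath_def by (rule the_equality) (rule apath_unique[OF _ q])
  with apath_unique[OF _ q] q show ?thesis
    by blast
qed

lemma tpath_arc:
  assumes "x \<in> pverts T" "(z, w) \<in> parcs T"
  shows "tpath x w = tpath x z @ [(z, w)] \<or> tpath x z = tpath x w @ [(w, z)]"
proof -
  have zw: "z \<in> pverts T" "w \<in> pverts T"
    using assms(2) by (auto dest: wellformed')
  have p: "apath x (tpath x z) z"
    using apath_iff_tpath[OF assms(1) zw(1)] by simp
  show ?thesis
  proof (cases "w \<in> set (pawalk_verts x (tpath x z))")
    case True
    then obtain q where "tpath x z = q @ [(w, z)]" "apath x q w"
      using apath_neighbor_on_path[OF p assms(2)] by blast
    then show ?thesis
      using apath_iff_tpath[OF assms(1) zw(2)] by simp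
  next
    case False
    then show ?thesis
      using apath_snoc[OF p assms(2)] apath_iff_tpath[OF assms(1) zw(2)] by simp
  qed
qed

abbreviation tdist :: "'a \<Rightarrow> 'a \<Rightarrow> nat" where
  "tdist \<equiv> gdist T"

lemma tdist_le: "awalk u p v \<Longrightarrow> tdist u v \<le> length p"
  unfolding gdist_def by (rule Least_le) auto

lemma tdist_attained:
  assumes "u \<in> pverts T" "v \<in> pverts T"
  shows "\<exists>p. awalk u p v \<and> length p = tdist u v"
  unfolding gdist_def
  by (rule LeastI_ex[of "\<lambda>k. \<exists>p. awalk u p v \<and> length p = k"])
    (use apath_exists[OF assms] in \<open>auto simp: apath_def\<close>)

lemma tdist_self [simp]: "u \<in> pverts T \<Longrightarrow> tdist u u = 0"
  using tdist_le[of u "[]" u] by (simp add: awalk_Nil_iff)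

lemma tdist_0D: "u \<in> pverts T \<Longrightarrow> v \<in> pverts T \<Longrightarrow> tdist u v = 0 \<Longrightarrow> u = v"
  using tdist_attained[of u v] by (auto simp: awalk_Nil_iff)

lemma tdist_commute: "u \<in> pverts T \<Longrightarrow> v \<in> pverts T \<Longrightarrow> tdist u v = tdist v u"
proof -
  have "tdist u v \<le> tdist v u" if uv: "u \<in> pverts T" "v \<in> pverts T" for u v
  proof -
    obtain p where p: "awalk v p u" "length p = tdist v u"
      using tdist_attained[OF uv(2,1)] by auto
    have "length (rev_path p) = length p"
      by (induction p) auto
    then show ?thesis
      using tdist_le[of u "rev_path p" v] p by simp
  qed
  then show "u \<in> pverts T \<Longrightarrow> v \<in> pverts T \<Longrightarrow> tdist u v = tdist v u"
    by (simp add: le_antisym)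
qed

lemma tdist_triangle:
  assumes "u \<in> pverts T" "v \<in> pverts T" "w \<in> pverts T"
  shows "tdist u w \<le> tdist u v + tdist v w"
proof -
  obtain p q where "awalk u p v" "length p = tdist u v" "awalk v q w" "length q = tdist v w"
    using tdist_attained assms by metis
  then show ?thesis
    using tdist_le[OF awalk_appendI[of u p v q w]] by simp
qed

lemma arc_iff_tdist:
  assumes "u \<in> pverts T" "v \<in> pverts T"
  shows "(u, v) \<in> parcs T \<longleftrightarrow> tdist u v = 1"
proof
  assume uv: "(u, v) \<in> parcs T"
  then have "tdist u v \<le> 1"
    using tdist_le[of u "[(u, v)]" v] assms by (simp add: awalk_simps)
  moreover have "tdist u v \<noteq> 0"
    using tdist_0D[OF assms] no_loops'[OF uv] by auto
  ultimately show "tdist u v = 1" by linarith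
next
  assume "tdist u v = 1"
  then obtain p where "awalk u p v" "length p = 1"
    using tdist_attained[OF assms] by auto
  then show "(u, v) \<in> parcs T"
    by (cases p) (auto simp: awalk_simps)
qed

text \<open>
  The Gromov product of \<open>y\<close> and \<open>z\<close> at \<open>x\<close>.  Common prefixes of paths from \<open>x\<close> satisfy the ultrametric
  inequality, which is the four-point condition for the distance.
\<close>

definition shared :: "'a \<Rightarrow> 'a \<Rightarrow> 'a \<Rightarrow> nat" where
  "shared x y z = length (longest_common_prefix (tpath x y) (tpath x z))"

lemma longest_common_prefix_snoc:
  "length (longest_common_prefix ps qs) \<le> length (longest_common_prefix ps (qs @ [e])) \<and>
   length (longest_common_prefix ps (qs @ [e])) \<le> Suc (length (longest_common_prefix ps qs))"
proof (induction ps arbitrary: qs)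
  case (Cons p ps)
  show ?case
    using Cons.IH[of "tl qs"] by (cases qs; cases ps) auto
qed simp

lemma ex_neighbor_nearer_shared:
  assumes V: "x \<in> pverts T" "y \<in> pverts T" "z \<in> pverts T" and "y \<noteq> z"
  shows "\<exists>w. (w, z) \<in> parcs T \<and>
    length (tpath x z) + 2 * shared x y w = Suc (length (tpath x w) + 2 * shared x y z)"
proof -
  let ?L = "longest_common_prefix (tpath x y) (tpath x z)"
  have y: "apath x (tpath x y) y" and z: "apath x (tpath x z) z"
    using apath_iff_tpath[OF V(1,2)] apath_iff_tpath[OF V(1,3)] by simp_all
  show ?thesis
  proof (cases "?L = tpath x z")
    case True
    then obtain s where s: "tpath x y = tpath x z @ s"
      using longest_common_prefix_prefix1[of "tpath x y" "tpath x z"] by (auto elim: prefixE)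
    have "s \<noteq> []"
    proof
      assume "s = []"
      then have "apath x (tpath x z) y" using y s by simp
      then show False using apath_ends[OF z] \<open>y \<noteq> z\<close> by auto
    qed
    then obtain e s' where s': "s = e # s'" by (cases s) auto
    have "apath x ((tpath x z @ [e]) @ s') y"
      using y s s' by simp
    then have e': "apath x (tpath x z @ [e]) (last (pawalk_verts x (tpath x z @ [e])))"
      by (rule apath_append_iff[THEN iffD1, THEN conjunct1])
    then obtain b where b: "e = (b, last (pawalk_verts x (tpath x z @ [e])))" "e \<in> parcs T"
        "apath x (tpath x z) b"
      by (rule apath_snocE) auto
    have "b = z"
      using apath_ends[OF z b(3)] by auto
    then have "fst e = z"
      using b(1) by (cases e) simp
    have e: "e \<in> parcs T"
      by (rule b(2))
    have "last (pawalk_verts x (tpath x z @ [e])) = snd e"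
      by (simp add: awalk_verts_conv)
    then have w: "tpath x (snd e) = tpath x z @ [e]"
      using apath_iff_tpath[OF V(1), of "snd e"] arc_snd_in_verts[OF e] e' by simp
    have "prefix (tpath x (snd e)) (tpath x y)"
      using s s' w by simp
    then have "longest_common_prefix (tpath x y) (tpath x (snd e)) = tpath x (snd e)"
      by (intro prefix_order.antisym longest_common_prefix_prefix2 longest_common_prefix_max_prefix)
        simp_all
    then show ?thesis
      using e \<open>fst e = z\<close> True w arcs_symmetric[of z "snd e"]
      by (intro exI[of _ "snd e"]) (auto simp: shared_def)
  next
    case False
    then have "tpath x z \<noteq> []" by auto
    then obtain q e where "tpath x z = q @ [e]"
      by (cases "tpath x z" rule: rev_cases) auto
    moreover from this z obtain w where "e = (w, z)" "(w, z) \<in> parcs T" "apath x q w"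
      using apath_snocE by metis
    ultimately have q: "tpath x z = q @ [(w, z)]" "(w, z) \<in> parcs T" "apath x q w"
      by simp_all
    then have w: "tpath x w = q"
      using apath_iff_tpath[OF V(1), of w q] in_arcsD1[OF q(2)] by simp
    have "prefix ?L q"
      using False longest_common_prefix_prefix2[of "tpath x y" "tpath x z"] q(1)
      by (auto simp: prefix_snoc)
    with longest_common_prefix_prefix1
    have "prefix ?L (longest_common_prefix (tpath x y) q)"
      by (rule longest_common_prefix_max_prefix)
    then have "length ?L \<le> length (longest_common_prefix (tpath x y) q)"
      by (rule prefix_length_le)
    moreover have "length (longest_common_prefix (tpath x y) q) \<le> length ?L"
      using longest_common_prefix_snoc q(1) by metis
    ultimately show ?thesis
      using q(1,2) w by (intro exI[of _ w]) (auto simp: shared_def)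
  qed
qed

lemma shared_le: "shared x y z \<le> length (tpath x y)" "shared x y z \<le> length (tpath x z)"
  by (simp_all add: shared_def prefix_length_le longest_common_prefix_prefix1
      longest_common_prefix_prefix2)

lemma longest_common_prefix_self: "longest_common_prefix ps ps = ps"
  by (induction ps) auto

lemma tdist_shared:
  assumes V: "x \<in> pverts T" "y \<in> pverts T" "z \<in> pverts T"
  shows "tdist y z + 2 * shared x y z = length (tpath x y) + length (tpath x z)"
proof (rule antisym)
  have "length (tpath x y) + length (tpath x z) \<le> length p + 2 * shared x y z"
    if "awalk y p z" for p
    using that
  proof (induction p arbitrary: z rule: rev_induct)
    case Nil
    then show ?case
      by (auto simp: awalk_Nil_iff shared_def longest_common_prefix_self)
  next
    case (snoc e p)
    then obtain w where w: "e = (w, z)" "(w, z) \<in> parcs T" "awalk y p w"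
      by (cases e) (auto simp: awalk_simps)
    then show ?case
      using snoc.IH[OF w(3)] tpath_arc[OF V(1) w(2)]
        longest_common_prefix_snoc[of "tpath x y" "tpath x w" "(w, z)"]
        longest_common_prefix_snoc[of "tpath x y" "tpath x z" "(z, w)"]
      by (auto simp: shared_def)
  qed
  then show "length (tpath x y) + length (tpath x z) \<le> tdist y z + 2 * shared x y z"
    using tdist_attained[OF V(2,3)] by metis
  show "tdist y z + 2 * shared x y z \<le> length (tpath x y) + length (tpath x z)"
    using V(3)
  proof (induction "length (tpath x y) + length (tpath x z) - 2 * shared x y z" arbitrary: z)
    case (0 z)
    show ?case
    proof (cases "y = z")
      case False
      from ex_neighbor_nearer_shared[OF V(1,2) \<open>z \<in> pverts T\<close> False]
      obtain w where w: "length (tpath x z) + 2 * shared x y w =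
          Suc (length (tpath x w) + 2 * shared x y z)" by auto
      with 0 shared_le[of x y z] shared_le[of x y w] show ?thesis by linarith
    qed (use V shared_le[of x y z] in auto)
  next
    case (Suc k z)
    show ?case
    proof (cases "y = z")
      case False
      from ex_neighbor_nearer_shared[OF V(1,2) \<open>z \<in> pverts T\<close> False]
      obtain w where w: "(w, z) \<in> parcs T" "length (tpath x z) + 2 * shared x y w =
          Suc (length (tpath x w) + 2 * shared x y z)" by auto
      then have "w \<in> pverts T" by (simp add: in_arcsD1)
      then have "tdist y w + 2 * shared x y w \<le> length (tpath x y) + length (tpath x w)"
        using Suc.hyps(2) w(2) by (intro Suc.hyps(1)) linarith+
      moreover have "tdist y z \<le> tdist y w + 1"
        using tdist_triangle[OF V(2) \<open>w \<in> pverts T\<close> Suc.prems] arc_iff_tdist w(1)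
          \<open>w \<in> pverts T\<close> Suc.prems by simp
      ultimately show ?thesis using w(2) by linarith
    qed (use V shared_le[of x y z] in auto)
  qed
qed

lemma shared_ultrametric: "min (shared x y z) (shared x y w) \<le> shared x z w"
proof -
  let ?A = "longest_common_prefix (tpath x y) (tpath x z)"
  let ?B = "longest_common_prefix (tpath x y) (tpath x w)"
  have AB: "prefix ?A ?B \<or> prefix ?B ?A"
    by (rule prefix_same_cases) (rule longest_common_prefix_prefix1)+
  define C where "C = (if prefix ?A ?B then ?A else ?B)"
  have "prefix C ?A" "prefix C ?B"
    using AB by (auto simp: C_def)
  then have "prefix C (tpath x z)" "prefix C (tpath x w)"
    using prefix_order.trans[OF _ longest_common_prefix_prefix2] by auto
  then have "length C \<le> shared x z w"
    unfolding shared_def by (intro prefix_length_le longest_common_prefix_max_prefix)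
  moreover have "min (shared x y z) (shared x y w) \<le> length C"
    by (auto simp: C_def shared_def)
  ultimately show ?thesis by linarith
qed

lemma length_tpath:
  assumes "x \<in> pverts T" "y \<in> pverts T"
  shows "length (tpath x y) = tdist x y"
proof -
  have "tpath x x = []"
    using apath_iff_tpath[OF assms(1,1), of "[]"] assms by (simp add: apath_Nil_iff)
  then show ?thesis
    using tdist_shared[OF assms(1,1,2)] by (simp add: shared_def)
qed

lemma four_point:
  assumes "x \<in> pverts T" "y \<in> pverts T" "z \<in> pverts T" "w \<in> pverts T"
  shows "tdist x y + tdist z w \<le> max (tdist x z + tdist y w) (tdist x w + tdist y z)"
proof -
  have "tdist y z + 2 * shared x y z = tdist x y + tdist x z"
    "tdist y w + 2 * shared x y w = tdist x y + tdist x w"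
    "tdist z w + 2 * shared x z w = tdist x z + tdist x w"
    using tdist_shared[of x] length_tpath[of x] assms by simp_all
  with shared_ultrametric[of x y z w] show ?thesis
    by linarith
qed

lemma ex_nearer_neighbor:
  assumes "u \<in> pverts T" "v \<in> pverts T" "u \<noteq> v"
  shows "\<exists>w. (u, w) \<in> parcs T \<and> tdist u v = Suc (tdist w v)"
proof -
  obtain p where p: "awalk u p v" "length p = tdist u v"
    using tdist_attained assms by metis
  with \<open>u \<noteq> v\<close> obtain w q where q: "p = (u, w) # q" "(u, w) \<in> parcs T" "awalk w q v"
    by (cases p) (auto simp: awalk_simps)
  then have "tdist w v \<le> length q" by (simp add: tdist_le)
  moreover have "tdist u v \<le> 1 + tdist w v"
    using tdist_triangle[of u w v] assms q(2) in_arcsD2[OF q(2)] arc_iff_tdist[of u w] by simp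
  moreover have "tdist u v = Suc (length q)"
    using p(2) q(1) by simp
  ultimately show ?thesis using q(2) by (intro exI[of _ w]) simp
qed

lemma arc_tdist_cases:
  assumes "u \<in> pverts T" "(a, b) \<in> parcs T"
  shows "tdist u b = Suc (tdist u a) \<or> tdist u a = Suc (tdist u b)"
proof -
  have "a \<in> pverts T" "b \<in> pverts T"
    using assms(2) by (auto dest: wellformed')
  then show ?thesis
    using tpath_arc[OF assms] length_tpath[OF assms(1), of a] length_tpath[OF assms(1), of b]
    by (metis length_append_singleton)
qed

lemma nearer_neighbor_unique:
  assumes "u \<in> pverts T" "(a, c) \<in> parcs T" "(b, c) \<in> parcs T"
    "tdist u c = Suc (tdist u a)" "tdist u c = Suc (tdist u b)"
  shows "a = b"
proof -
  have V: "a \<in> pverts T" "b \<in> pverts T" "c \<in> pverts T"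
    using assms(2,3) by (auto dest: wellformed')
  have "tpath u c = tpath u a @ [(a, c)]" "tpath u c = tpath u b @ [(b, c)]"
    using tpath_arc[OF assms(1,2)] tpath_arc[OF assms(1,3)] assms(4,5) V
      length_tpath[OF assms(1)]
    by (metis length_append_singleton n_not_Suc_n Suc_n_not_le_n lessI less_imp_le_nat)+
  then show ?thesis by simp
qed

lemma ex_nearer_neighbor':
  assumes "u \<in> pverts T" "v \<in> pverts T" "u \<noteq> v"
  shows "\<exists>w. (w, v) \<in> parcs T \<and> tdist u v = Suc (tdist u w)"
proof -
  obtain w where w: "(v, w) \<in> parcs T" "tdist v u = Suc (tdist w u)"
    using ex_nearer_neighbor[OF assms(2,1)] assms(3) by blast
  then have "w \<in> pverts T" by (simp add: in_arcsD2)
  then show ?thesis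
    using w arcs_symmetric[OF w(1)] tdist_commute assms by metis
qed

lemma leaves_iff:
  "v \<in> leaves T \<longleftrightarrow> v \<in> pverts T \<and> (\<forall>a b. (v, a) \<in> parcs T \<longrightarrow> (v, b) \<in> parcs T \<longrightarrow> a = b)"
proof -
  have fin: "finite (out_arcs (with_proj T) v)"
    by (rule finite_out_arcs)
  have out: "out_arcs (with_proj T) v = {e \<in> parcs T. fst e = v}"
    by (auto simp: out_arcs_def)
  have "out_degree (with_proj T) v \<le> 1 \<longleftrightarrow>
    (\<forall>e \<in> out_arcs (with_proj T) v. \<forall>f \<in> out_arcs (with_proj T) v. e = f)"
    unfolding out_degree_def using card_le_Suc0_iff_eq[OF fin] by simp
  then show ?thesis
    unfolding leaves_def out by force
qed

lemma leaf_beyond: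
  assumes "u \<in> pverts T" "w \<in> pverts T"
  shows "\<exists>l \<in> leaves T. tdist u l = tdist u w + tdist w l"
proof -
  define B where "B = {l \<in> pverts T. tdist u l = tdist u w + tdist w l}"
  have "finite B" "w \<in> B"
    using assms pair_finite_verts by (auto simp: B_def)
  then have "Max (tdist u ` B) \<in> tdist u ` B"
    by (intro Max_in) auto
  then obtain l where "l \<in> B" "tdist u l = Max (tdist u ` B)"
    by force
  with \<open>finite B\<close> have l: "l \<in> B" "\<And>k. k \<in> B \<Longrightarrow> tdist u k \<le> tdist u l"
    by simp_all
  from l(1) have lB: "l \<in> pverts T" "tdist u l = tdist u w + tdist w l"
    by (simp_all add: B_def)
  have "l \<in> leaves T"
  proof (rule ccontr)
    assume "l \<notin> leaves T"
    then obtain a b where ab: "(l, a) \<in> parcs T" "(l, b) \<in> parcs T" "a \<noteq> b"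
      using lB by (auto simp: leaves_iff)
    have nearer: "tdist u l = Suc (tdist u c)" if c: "(l, c) \<in> parcs T" for c
    proof (rule ccontr)
      assume "tdist u l \<noteq> Suc (tdist u c)"
      then have far: "tdist u c = Suc (tdist u l)"
        using arc_tdist_cases[OF assms(1) c] by simp
      have cV: "c \<in> pverts T" by (rule in_arcsD2[OF c])
      have "tdist l c = 1"
        using arc_iff_tdist[of l c] c cV lB by simp
      then have "tdist w c \<le> Suc (tdist w l)" "tdist u c \<le> tdist u w + tdist w c"
        using tdist_triangle[of w l c] tdist_triangle[of u w c] assms cV lB by simp_all
      then have "c \<in> B"
        using far lB cV by (simp add: B_def)
      with l(2)[of c] far show False by simp
    qed
    have "(a, l) \<in> parcs T" "(b, l) \<in> parcs T"
      using ab(1,2) by (auto intro: arcs_symmetric)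
    then show False
      using nearer_neighbor_unique[OF assms(1) _ _ nearer[OF ab(1)] nearer[OF ab(2)]] ab(3)
      by blast
  qed
  then show ?thesis using lB by auto
qed

section \<open>The game on a tree\<close>

lemma remaining_Suc:
  "parcs (remaining T x (Suc t)) = parcs (remaining T x t) - {(x t, x (Suc t)), (x (Suc t), x t)}"
  by (auto simp: remaining_def less_Suc_eq)

lemma remaining_0 [simp]: "remaining T x 0 = T"
  by (simp add: remaining_def)

lemma parcs_remaining_subset: "parcs (remaining T x t) \<subseteq> parcs T"
  by (auto simp: remaining_def)

lemma finite_remaining: "finite (parcs (remaining T x t))"
  using parcs_remaining_subset pair_finite_arcs finite_subset by blast

lemma trajectory_in_verts: "robber_trajectory T x \<Longrightarrow> x t \<in> pverts T"
proof (induction t)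
  case (Suc t)
  then have "x t \<in> pverts T" "may_move (remaining T x t) (x t) (x (Suc t))"
    by (auto simp: robber_trajectory_def)
  then show ?case
    using parcs_remaining_subset[of x t] by (auto simp: may_move_def dest: in_arcsD2)
qed (simp add: robber_trajectory_def)

definition toward :: "'a pair_pre_digraph \<Rightarrow> 'a \<Rightarrow> 'a \<Rightarrow> 'a" where
  "toward H v c =
     (if \<exists>c'. (c, c') \<in> parcs H \<and> tdist v c = Suc (tdist v c')
      then SOME c'. (c, c') \<in> parcs H \<and> tdist v c = Suc (tdist v c')
      else c)"

lemma toward_nearer:
  assumes "\<exists>c'. (c, c') \<in> parcs H \<and> tdist v c = Suc (tdist v c')"
  shows "(c, toward H v c) \<in> parcs H" "tdist v c = Suc (tdist v (toward H v c))"
  using someI_ex[OF assms] assms by (simp_all add: toward_def)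

lemma may_move_toward: "may_move H c (toward H v c)"
proof (cases "\<exists>c'. (c, c') \<in> parcs H \<and> tdist v c = Suc (tdist v c')")
  case True
  then show ?thesis using toward_nearer[OF True] by (simp add: may_move_def)
next
  case False
  then have "toward H v c = c"
    unfolding toward_def by (rule if_not_P)
  then show ?thesis by (simp add: may_move_def)
qed

text \<open>The argument lists the past positions of the robber, as for \<^typ>\<open>'a cop_strategy\<close>, so that
  \<open>(!) xs\<close> agrees with his trajectory so far.\<close>

fun chase :: "'a list \<Rightarrow> 'a cop_strategy" where
  "chase cs xs =
     (if xs = [] then cs
      else map (toward (remaining T ((!) xs) (length xs - 1)) (last xs)) (chase cs (butlast xs)))"

declare chase.simps [simp del]

lemma chase_Nil [simp]: "chase cs [] = cs"
  by (simp add: chase.simps)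

lemma cops_at_chase_0: "cops_at (chase cs) x 0 = cs"
  by (simp add: cops_at_def)

lemma cops_at_chase_Suc:
  "cops_at (chase cs) x (Suc t) = map (toward (remaining T x t) (x t)) (cops_at (chase cs) x t)"
proof -
  have nth: "(map x [0..<t] @ [x t]) ! s = x s" if "s \<le> t" for s
    using that by (auto simp: nth_append)
  have "remaining T ((!) (map x [0..<t] @ [x t])) t = remaining T x t"
    unfolding remaining_def
    by (intro arg_cong[where f = "\<lambda>A. T\<lparr>parcs := parcs T - A\<rparr>"] SUP_cong refl) (simp add: nth)
  then show ?thesis
    by (subst (1) cops_at_def) (simp add: chase.simps[of cs "map x [0..<t] @ [x t]"] cops_at_def)
qed

lemma legal_chase:
  assumes "set cs \<subseteq> pverts T"
  shows "legal_cop_strategy T (length cs) (chase cs)"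
  using assms
  by (auto simp: legal_cop_strategy_def cops_at_chase_Suc list_all2_conv_all_nth may_move_toward)

text \<open>
  \<open>B\<close> contains the component of the robber's position \<open>v\<close> in the remaining graph \<open>H\<close>.  Only at \<open>v\<close> itself
  may burnt edges have led out of \<open>B\<close>, so the leaves of \<open>T\<close> in \<open>B\<close> are the possible ends of his flight.
\<close>

definition blocks :: "'a set \<Rightarrow> 'a \<Rightarrow> 'a \<Rightarrow> 'a \<Rightarrow> bool" where
  "blocks B v l c \<longleftrightarrow> c \<in> B \<and> c \<noteq> v \<and> tdist v c + tdist c l = tdist v l"

definition region :: "'a pair_pre_digraph \<Rightarrow> 'a \<Rightarrow> 'a set \<Rightarrow> bool" where
  "region H v B \<longleftrightarrow>
     B \<subseteq> pverts T \<and> v \<in> B \<and> parcs H \<subseteq> parcs T \<and>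
     (\<forall>a \<in> B. \<forall>b \<in> B. (a, b) \<in> parcs T \<longrightarrow> (a, b) \<in> parcs H) \<and>
     (\<forall>z. (v, z) \<in> parcs H \<longrightarrow> z \<in> B) \<and>
     (\<forall>y \<in> B. y \<noteq> v \<longrightarrow> (\<forall>z. (y, z) \<in> parcs T \<longrightarrow> z \<in> B)) \<and>
     (\<forall>y \<in> B. \<forall>z \<in> pverts T. tdist v z + tdist z y = tdist v y \<longrightarrow> z \<in> B) \<and>
     (\<exists>l \<in> leaves T. l \<in> B \<and> l \<noteq> v)"

definition confined :: "'a pair_pre_digraph \<Rightarrow> 'a \<Rightarrow> 'a list \<Rightarrow> 'a set \<Rightarrow> bool" where
  "confined H v cs B \<longleftrightarrow> region H v B \<and>
     (\<forall>l \<in> leaves T. l \<in> B \<longrightarrow> l \<noteq> v \<longrightarrow> (\<exists>c \<in> set cs. blocks B v l c))"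

lemma toward_blocks:
  assumes reg: "region H v B" and bl: "blocks B v l c" and l: "l \<in> pverts T"
    and nv: "toward H v c \<noteq> v"
  shows "blocks B v l (toward H v c)" "tdist v c = Suc (tdist v (toward H v c))"
proof -
  have B: "B \<subseteq> pverts T" "v \<in> B" "c \<in> B" "c \<noteq> v" and on: "tdist v c + tdist c l = tdist v l"
    using reg bl unfolding region_def blocks_def by blast+
  have convex: "z \<in> B" if "z \<in> pverts T" "tdist v z + tdist z c = tdist v c" for z
    using reg that B(3) unfolding region_def by blast
  have V: "v \<in> pverts T" "c \<in> pverts T" using B by auto
  have between: "z \<in> B \<and> tdist v z + tdist z c = tdist v c"
    if z: "(c, z) \<in> parcs T" "tdist v c = Suc (tdist v z)" for z
  proof -
    have zV: "z \<in> pverts T" by (rule in_arcsD2[OF z(1)])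
    have "tdist z c = 1"
      using arc_iff_tdist[OF zV V(2)] arcs_symmetric[OF z(1)] by simp
    then show ?thesis using convex[OF zV] z(2) by simp
  qed
  obtain w where w: "(w, c) \<in> parcs T" "tdist v c = Suc (tdist v w)"
    using ex_nearer_neighbor'[OF V] B(4) by blast
  have cw: "(c, w) \<in> parcs T" by (rule arcs_symmetric[OF w(1)])
  have "(c, w) \<in> parcs H"
    using reg B(3) between[OF cw w(2)] cw unfolding region_def by blast
  then have ex: "\<exists>c'. (c, c') \<in> parcs H \<and> tdist v c = Suc (tdist v c')"
    using w(2) by blast
  note t = toward_nearer[OF ex]
  have tT: "(c, toward H v c) \<in> parcs T"
    using t(1) reg unfolding region_def by blast
  have tV: "toward H v c \<in> pverts T" by (rule in_arcsD2[OF tT])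
  show "tdist v c = Suc (tdist v (toward H v c))" by (rule t(2))
  have 1: "tdist (toward H v c) c = 1"
    using arc_iff_tdist[OF tV V(2)] arcs_symmetric[OF tT] by simp
  have "tdist v l \<le> tdist v (toward H v c) + tdist (toward H v c) l"
    "tdist (toward H v c) l \<le> tdist (toward H v c) c + tdist c l"
    using tdist_triangle V l tV by simp_all
  then show "blocks B v l (toward H v c)"
    using 1 on t(2) between[OF tT t(2)] nv unfolding blocks_def by simp
qed

lemma confined_cops_move:
  assumes conf: "confined H v cs B" and nv: "v \<notin> set (map (toward H v) cs)"
  shows "confined H v (map (toward H v) cs) B"
  unfolding confined_def
proof (intro conjI ballI impI)
  show reg: "region H v B"
    using conf by (simp add: confined_def)
  fix l assume l: "l \<in> leaves T" "l \<in> B" "l \<noteq> v"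
  then obtain c where c: "c \<in> set cs" "blocks B v l c"
    using conf unfolding confined_def by meson
  moreover have "l \<in> pverts T" using l(1) by (simp add: leaves_iff)
  moreover have "toward H v c \<noteq> v" using nv imageI[OF c(1), of "toward H v"] by auto
  ultimately have "blocks B v l (toward H v c)"
    using toward_blocks(1)[OF reg] by blast
  with c(1) show "\<exists>c \<in> set (map (toward H v) cs). blocks B v l c" by auto
qed

lemma nearer_neighbor_on_geodesic:
  assumes "u \<in> pverts T" "y \<in> pverts T" "l \<in> pverts T" "y \<noteq> u"
    and "tdist u y + tdist y l = tdist u l" and "(u, w) \<in> parcs T" "tdist u l = Suc (tdist w l)"
  shows "tdist u y = Suc (tdist w y)"
proof -
  obtain n where n: "(u, n) \<in> parcs T" "tdist u y = Suc (tdist n y)"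
    using ex_nearer_neighbor[OF assms(1,2)] assms(4) by blast
  have nV: "n \<in> pverts T" and wV: "w \<in> pverts T"
    using n(1) assms(6) by (auto dest: in_arcsD2)
  have "tdist n l \<le> tdist n y + tdist y l"
    using tdist_triangle[of n y l] assms nV by simp
  then have "tdist u l \<noteq> Suc (tdist u l)" "Suc (tdist n l) \<le> tdist u l"
    using assms(5) n(2) by simp_all
  then have "tdist u l = Suc (tdist n l)"
    using arc_tdist_cases[OF assms(3) n(1)] tdist_commute nV assms(1,3) by (metis Suc_n_not_le_n le_SucI le_Suc_eq)
  then have "n = w"
    using nearer_neighbor_unique[of l n u w] arcs_symmetric[OF n(1)] arcs_symmetric[OF assms(6)]
      assms(1,3,7) tdist_commute nV wV by metis
  with n(2) show ?thesis by simp
qed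

lemma ahead_closed:
  assumes uw: "(u, w) \<in> parcs T" and yz: "(y, z) \<in> parcs T" and "y \<noteq> w"
    and y: "tdist u y = Suc (tdist w y)"
  shows "tdist u z = Suc (tdist w z)"
proof -
  have V: "u \<in> pverts T" "w \<in> pverts T" "y \<in> pverts T" "z \<in> pverts T"
    using uw yz by (auto dest: wellformed')
  have "tdist w y \<noteq> 0"
    using tdist_0D[OF V(2,3)] \<open>y \<noteq> w\<close> by auto
  moreover have "tdist u w = 1" "tdist y z = 1"
    using uw yz arc_iff_tdist V by simp_all
  moreover have "tdist u z = Suc (tdist w z) \<or> tdist w z = Suc (tdist u z)"
    using arc_tdist_cases[OF V(4) uw] tdist_commute V by metis
  moreover have "tdist w z \<le> Suc (tdist w y)" "tdist u y \<le> Suc (tdist u z)"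
    using arc_tdist_cases[OF V(2) yz] arc_tdist_cases[OF V(1) yz] by auto
  moreover have "tdist u y + tdist w z \<le> max (tdist u w + tdist y z) (tdist u z + tdist y w)"
    by (rule four_point) (use V in auto)
  moreover have "tdist y w = tdist w y"
    by (rule tdist_commute) (use V in auto)
  ultimately show ?thesis
    using y by linarith
qed

lemma beyond_closed:
  assumes w: "w \<in> pverts T" and l: "l \<in> pverts T" and "S \<subseteq> pverts T"
    and closed: "\<And>y z. y \<in> S \<Longrightarrow> y \<noteq> w \<Longrightarrow> (y, z) \<in> parcs T \<Longrightarrow> z \<in> S"
    and "y \<in> S" "y \<noteq> w" "tdist w l = tdist w y + tdist y l"
  shows "l \<in> S"
  using assms(5-)
proof (induction "tdist y l" arbitrary: y)
  case 0
  then have "y = l"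
    using tdist_0D[of y l] l \<open>S \<subseteq> pverts T\<close> by auto
  with 0 show ?case by simp
next
  case (Suc k)
  have yV: "y \<in> pverts T"
    using Suc.prems \<open>S \<subseteq> pverts T\<close> by blast
  have "y \<noteq> l"
    using Suc.hyps(2) l by auto
  then obtain n where n: "(y, n) \<in> parcs T" "tdist y l = Suc (tdist n l)"
    using ex_nearer_neighbor[OF yV l] by blast
  have nV: "n \<in> pverts T" by (rule in_arcsD2[OF n(1)])
  have "tdist y n = 1"
    using arc_iff_tdist[OF yV nV] n(1) by simp
  then have "tdist w n \<le> tdist w y + 1" "tdist w l \<le> tdist w n + tdist n l"
    using tdist_triangle[of w y n] tdist_triangle[of w n l] w yV nV l by simp_all
  then have wn: "tdist w n = Suc (tdist w y)" "tdist w l = tdist w n + tdist n l"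
    using n(2) Suc.prems(3) by simp_all
  have "n \<noteq> w"
    using wn(1) w by auto
  moreover have "n \<in> S"
    by (rule closed[OF Suc.prems(1,2) n(1)])
  moreover have "k = tdist n l"
    using Suc.hyps(2) n(2) by simp
  ultimately show ?case
    using Suc.hyps(1) wn(2) by blast
qed

lemma confined_robber_move:
  assumes conf: "confined H u cs B" and uw: "(u, w) \<in> parcs H"
    and H': "parcs H' = parcs H - {(u, w), (w, u)}" and nw: "w \<notin> set cs"
  shows "confined H' w cs {y \<in> B. tdist u y = Suc (tdist w y)}" (is "confined H' w cs ?B")
proof -
  have sub: "B \<subseteq> pverts T" and uB: "u \<in> B" and HT: "parcs H \<subseteq> parcs T"
    and within: "\<And>a b. a \<in> B \<Longrightarrow> b \<in> B \<Longrightarrow> (a, b) \<in> parcs T \<Longrightarrow> (a, b) \<in> parcs H"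
    and exits: "\<And>z. (u, z) \<in> parcs H \<Longrightarrow> z \<in> B"
    and nbrs: "\<And>y z. y \<in> B \<Longrightarrow> y \<noteq> u \<Longrightarrow> (y, z) \<in> parcs T \<Longrightarrow> z \<in> B"
    and convex: "\<And>y z. y \<in> B \<Longrightarrow> z \<in> pverts T \<Longrightarrow> tdist u z + tdist z y = tdist u y \<Longrightarrow> z \<in> B"
    using conf unfolding confined_def region_def by blast+
  have block: "\<And>l. l \<in> leaves T \<Longrightarrow> l \<in> B \<Longrightarrow> l \<noteq> u \<Longrightarrow> \<exists>c \<in> set cs. blocks B u l c"
    using conf unfolding confined_def by meson
  have uwT: "(u, w) \<in> parcs T" using uw HT by blast
  have wu: "w \<noteq> u" using no_loops'[OF uwT] by simp
  have V: "u \<in> pverts T" "w \<in> pverts T" using uwT by (auto dest: wellformed')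
  have d1: "tdist u w = 1" using arc_iff_tdist[OF V] uwT by simp
  have wB: "w \<in> ?B" using exits[OF uw] d1 V by simp
  have uB': "u \<notin> ?B" using V by simp
  have nbrs': "z \<in> ?B" if "y \<in> ?B" "y \<noteq> w" "(y, z) \<in> parcs T" for y z
    using that ahead_closed[OF uwT that(3,2)] nbrs[of y z] uB' by blast
  have exits': "z \<in> ?B" if z: "(w, z) \<in> parcs H'" for z
  proof -
    have wz: "(w, z) \<in> parcs T" and zu: "z \<noteq> u" using z H' HT by auto
    have zV: "z \<in> pverts T" by (rule in_arcsD2[OF wz])
    have "tdist u z \<noteq> 0" using tdist_0D[OF V(1) zV] zu by auto
    moreover have "tdist w z = 1" using arc_iff_tdist[OF V(2) zV] wz by simp
    ultimately have "tdist u z = Suc (tdist w z)"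
      using arc_tdist_cases[OF V(1) wz] d1 by auto
    then show ?thesis
      using nbrs[of w z] wB wu wz by blast
  qed
  have convex': "z \<in> ?B" if z: "y \<in> ?B" "z \<in> pverts T" "tdist w z + tdist z y = tdist w y" for y z
  proof -
    have yV: "y \<in> pverts T" using z(1) sub by blast
    have "tdist u y \<le> tdist u z + tdist z y" "tdist u z \<le> tdist u w + tdist w z"
      using tdist_triangle V yV z(2) by simp_all
    then have "tdist u z = Suc (tdist w z)" "tdist u z + tdist z y = tdist u y"
      using z d1 by simp_all
    then show ?thesis using convex[of y z] z by simp
  qed
  have block': "\<exists>c \<in> set cs. blocks ?B w l c" if l: "l \<in> leaves T" "l \<in> ?B" "l \<noteq> w" for l
  proof -
    have lV: "l \<in> pverts T" using l(2) sub by blast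
    have lu: "l \<noteq> u" using l(2) uB' by blast
    obtain c where c: "c \<in> set cs" "blocks B u l c"
      using block[OF l(1) _ lu] l(2) by blast
    have cB: "c \<in> B" "c \<noteq> u" "tdist u c + tdist c l = tdist u l"
      using c(2) by (simp_all add: blocks_def)
    have "tdist u c = Suc (tdist w c)"
      using nearer_neighbor_on_geodesic[OF V(1) _ lV cB(2,3) uwT] cB(1) sub l(2) by blast
    then have "blocks ?B w l c"
      using cB l(2) c(1) nw by (auto simp: blocks_def)
    with c(1) show ?thesis by blast
  qed
  have "\<exists>l \<in> leaves T. l \<in> ?B \<and> l \<noteq> w"
  proof -
    have "w \<notin> leaves T"
    proof
      assume "w \<in> leaves T"
      then obtain c where c: "c \<in> set cs" "blocks B u w c"
        using block[of w] wB wu by blast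
      then have cV: "c \<in> pverts T" using sub by (auto simp: blocks_def)
      have "tdist u c \<noteq> 0" "tdist u c + tdist c w = 1"
        using c(2) d1 tdist_0D[OF V(1) cV] by (auto simp: blocks_def)
      then have "tdist c w = 0" by simp
      then show False using tdist_0D[OF cV V(2)] c(1) nw by simp
    qed
    then obtain a b where "(w, a) \<in> parcs T" "(w, b) \<in> parcs T" "a \<noteq> b"
      using V(2) by (auto simp: leaves_iff)
    then obtain z where z: "(w, z) \<in> parcs T" "z \<noteq> u" by metis
    have zB: "z \<in> ?B"
      by (rule exits') (use z wB wu within nbrs H' in blast)
    have zV: "z \<in> pverts T" by (rule in_arcsD2[OF z(1)])
    obtain l where l: "l \<in> leaves T" "tdist w l = tdist w z + tdist z l"
      using leaf_beyond[OF V(2) zV] by blast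
    have lV: "l \<in> pverts T" using l(1) by (simp add: leaves_iff)
    have "l \<in> ?B"
      by (rule beyond_closed[OF V(2) lV _ _ zB _ l(2)])
        (use sub nbrs' no_loops'[OF z(1)] in blast)+
    moreover have "tdist w z \<noteq> 0"
      using tdist_0D[OF V(2) zV] no_loops'[OF z(1)] by blast
    then have "l \<noteq> w" using l(2) V by auto
    ultimately show ?thesis using l(1) by blast
  qed
  moreover have "?B \<subseteq> pverts T" "parcs H' \<subseteq> parcs T"
    using sub HT H' by auto
  moreover have "(a, b) \<in> parcs H'" if "a \<in> ?B" "b \<in> ?B" "(a, b) \<in> parcs T" for a b
    using that within[of a b] uB' H' by blast
  ultimately have "region H' w ?B"
    unfolding region_def using wB nbrs' exits' convex' by blast
  then show ?thesis
    unfolding confined_def using block' by blast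
qed

lemma remaining_stay:
  assumes "x (Suc t) = x t"
  shows "remaining T x (Suc t) = remaining T x t"
proof (rule pair_pre_digraph.equality)
  have "(x t, x t) \<notin> parcs (remaining T x t)"
    using parcs_remaining_subset no_loops' by blast
  then show "parcs (remaining T x (Suc t)) = parcs (remaining T x t)"
    using assms by (simp add: remaining_Suc)
qed (simp_all add: remaining_def)

lemma leaf_nearer_neighbor:
  assumes l: "l \<in> leaves T" and p: "(p, l) \<in> parcs T" and v: "v \<in> pverts T" "v \<noteq> l"
  shows "tdist v l = Suc (tdist v p)"
proof -
  have lV: "l \<in> pverts T" using l by (simp add: leaves_iff)
  obtain w where w: "(w, l) \<in> parcs T" "tdist v l = Suc (tdist v w)"
    using ex_nearer_neighbor'[OF v(1) lV v(2)] by blast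
  have "w = p"
    using l arcs_symmetric[OF w(1)] arcs_symmetric[OF p] by (auto simp: leaves_iff)
  with w show ?thesis by simp
qed

lemma guard_blocks_after_move:
  assumes l: "l \<in> leaves T" and v: "v \<in> pverts T" "v \<noteq> l" and c: "c \<in> pverts T" "c \<noteq> v"
    and near: "tdist c l \<le> 2" and free: "toward T v c \<noteq> v"
  shows "blocks (pverts T) v l (toward T v c)"
proof -
  have lV: "l \<in> pverts T" using l by (simp add: leaves_iff)
  obtain w where w: "(w, c) \<in> parcs T" "tdist v c = Suc (tdist v w)"
    using ex_nearer_neighbor'[OF v(1) c(1)] c(2) by blast
  then have ex: "\<exists>c'. (c, c') \<in> parcs T \<and> tdist v c = Suc (tdist v c')"
    using arcs_symmetric by blast
  define c' where "c' = toward T v c"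
  have c': "(c, c') \<in> parcs T" "tdist v c = Suc (tdist v c')"
    unfolding c'_def by (rule toward_nearer[OF ex])+
  have c'V: "c' \<in> pverts T" by (rule in_arcsD2[OF c'(1)])
  have "tdist v c' + tdist c' l = tdist v l"
  proof (cases "tdist v c + tdist c l = tdist v l")
    case True
    have "tdist c' c = 1"
      using arc_iff_tdist[OF c'V c(1)] arcs_symmetric[OF c'(1)] by simp
    then have "tdist c' l \<le> 1 + tdist c l" "tdist v l \<le> tdist v c' + tdist c' l"
      using tdist_triangle[of c' c l] tdist_triangle[of v c' l] v c c'V lV by simp_all
    with True c'(2) show ?thesis by linarith
  next
    case False
    then have "c \<noteq> l" using lV by auto
    obtain p where p: "(p, l) \<in> parcs T"
      using ex_nearer_neighbor'[OF v(1) lV v(2)] by blast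
    have pV: "p \<in> pverts T" by (rule in_arcsD1[OF p])
    have vp: "tdist v l = Suc (tdist v p)" and cp: "tdist c l = Suc (tdist c p)"
      using leaf_nearer_neighbor[OF l p] v c \<open>c \<noteq> l\<close> by auto
    have "c \<noteq> p"
    proof
      assume "c = p"
      then have "tdist c l = 1" using cp c(1) by simp
      with vp \<open>c = p\<close> False show False by simp
    qed
    then have "tdist c p \<noteq> 0" using tdist_0D[OF c(1) pV] by blast
    then have "tdist c p = 1" using cp near by simp
    then have cpT: "(c, p) \<in> parcs T" using arc_iff_tdist[OF c(1) pV] by simp
    have "tdist v c = Suc (tdist v p)"
      using arc_tdist_cases[OF v(1) cpT] False vp cp \<open>tdist c p = 1\<close> by auto
    then have "c' = p"
      using nearer_neighbor_unique[OF v(1) arcs_symmetric[OF c'(1)] arcs_symmetric[OF cpT] c'(2)]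
      by simp
    moreover have "tdist p l = 1" using arc_iff_tdist[OF pV lV] p by simp
    ultimately show ?thesis using vp by simp
  qed
  with c'V free show ?thesis by (simp add: blocks_def c'_def)
qed

lemma chase_captures:
  assumes cs: "set cs \<subseteq> pverts T" and dom: "\<And>l. l \<in> leaves T \<Longrightarrow> \<exists>c \<in> set cs. tdist c l \<le> 2"
    and x: "robber_trajectory T x"
  shows "captured (chase cs) x"
proof (rule ccontr)
  let ?P = "cops_at (chase cs) x"
  let ?R = "remaining T x"
  assume "\<not> captured (chase cs) x"
  then have free: "x t \<notin> set (?P t)" "x t \<notin> set (?P (Suc t))" for t
    by (auto simp: captured_def)
  have xV: "x t \<in> pverts T" for t by (rule trajectory_in_verts[OF x])
  have step: "confined (?R (Suc t)) (x (Suc t)) (?P (Suc (Suc t))) B"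
    if "confined (?R (Suc t)) (x (Suc t)) (?P (Suc t)) B" for t B
    using confined_cops_move[OF that] free(2)[of "Suc t"] by (simp add: cops_at_chase_Suc)
  have never: False
    if "confined (?R t) (x t) (?P (Suc t)) B" "c \<in> set (?P (Suc t))" "l \<in> leaves T"
      "blocks B (x t) l c" for t B c l
    using that
  proof (induction "(card (parcs (?R t)), tdist (x t) c)" arbitrary: t B c l
      rule: wf_induct_rule[OF wf_lex_prod[OF wf_less_than wf_less_than]])
    case (1 t c B l)
    have lV: "l \<in> pverts T" using 1(4) by (simp add: leaves_iff)
    show False
    proof (cases "x (Suc t) = x t")
      case True
      then have stay: "?R (Suc t) = ?R t" by (rule remaining_stay)
      define c' where "c' = toward (?R (Suc t)) (x (Suc t)) c"
      have c': "c' \<in> set (?P (Suc (Suc t)))"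
        using 1(3) by (simp add: cops_at_chase_Suc[of cs x "Suc t"] c'_def)
      then have "c' \<noteq> x (Suc t)" using free(2)[of "Suc t"] by auto
      then have bl: "blocks B (x (Suc t)) l c'" and "tdist (x t) c = Suc (tdist (x (Suc t)) c')"
        using toward_blocks[of "?R t" "x t" B l c] 1(2,5) lV stay True
        by (simp_all add: c'_def confined_def)
      moreover have "confined (?R (Suc t)) (x (Suc t)) (?P (Suc (Suc t))) B"
        by (rule step) (use 1(2) stay True in simp)
      ultimately show False
        using 1(1)[of "Suc t" c'] c' 1(4) stay by simp
    next
      case False
      then have mv: "(x t, x (Suc t)) \<in> parcs (?R t)"
        using x by (auto simp: robber_trajectory_def may_move_def)
      define B' where "B' = {y \<in> B. tdist (x t) y = Suc (tdist (x (Suc t)) y)}"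
      have conf: "confined (?R (Suc t)) (x (Suc t)) (?P (Suc (Suc t))) B'"
        unfolding B'_def
        by (rule step, rule confined_robber_move[OF 1(2) mv])
          (use free(1)[of "Suc t"] in \<open>simp_all add: remaining_Suc\<close>)
      then obtain l' where l': "l' \<in> leaves T" "l' \<in> B'" "l' \<noteq> x (Suc t)"
        unfolding confined_def region_def by blast
      then obtain c' where c': "c' \<in> set (?P (Suc (Suc t)))" "blocks B' (x (Suc t)) l' c'"
        using conf unfolding confined_def by meson
      have "card (parcs (?R (Suc t))) < card (parcs (?R t))"
        by (rule psubset_card_mono[OF finite_remaining]) (use mv in \<open>auto simp: remaining_Suc\<close>)
      then show False
        using 1(1)[of "Suc t" c'] conf l'(1) c' by simp
    qed
  qed
  obtain l where l: "l \<in> leaves T" "l \<noteq> x 0"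
  proof (cases "pverts T = {x 0}")
    case True
    then have "x 0 \<in> leaves T"
      using in_arcsD2 by (auto simp: leaves_iff)
    then obtain c where "c \<in> set cs" using dom by blast
    then have "c = x 0" using cs True by blast
    with \<open>c \<in> set cs\<close> free(1)[of 0] show ?thesis by (simp add: cops_at_chase_0)
  next
    case False
    then obtain y where y: "y \<in> pverts T" "y \<noteq> x 0" using xV[of 0] by blast
    obtain l where l: "l \<in> leaves T" "tdist (x 0) l = tdist (x 0) y + tdist y l"
      using leaf_beyond[OF xV y(1)] by blast
    have "tdist (x 0) y \<noteq> 0" using tdist_0D[OF xV[of 0] y(1)] y(2) by auto
    then have "l \<noteq> x 0" using l(2) xV by auto
    with l(1) show ?thesis using that by blast
  qed
  have block: "\<exists>c \<in> set (?P 1). blocks (pverts T) (x 0) l c" if l: "l \<in> leaves T" "l \<noteq> x 0" for l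
  proof -
    obtain c where c: "c \<in> set cs" "tdist c l \<le> 2" using dom l by blast
    define c' where "c' = toward T (x 0) c"
    have c': "c' \<in> set (?P 1)"
      using c(1) by (simp add: cops_at_chase_Suc[of cs x 0, simplified] cops_at_chase_0 c'_def)
    have "c \<noteq> x 0" "c' \<noteq> x 0"
      using free[of 0] c(1) c' by (auto simp: cops_at_chase_0)
    then have "blocks (pverts T) (x 0) l c'"
      unfolding c'_def using guard_blocks_after_move[OF l(1) xV[of 0]] l(2) c cs by blast
    with c' show ?thesis by blast
  qed
  have "region T (x 0) (pverts T)"
    unfolding region_def using xV l by (auto dest: in_arcsD2 simp: leaves_iff)
  then have "confined (?R 0) (x 0) (?P (Suc 0)) (pverts T)"
    using block by (simp add: confined_def)
  then show False
    using never[of 0 "pverts T"] block[OF l] l(1) by auto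
qed

lemma cops_win_if_dominating:
  assumes "set cs \<subseteq> pverts T" "\<And>l. l \<in> leaves T \<Longrightarrow> \<exists>c \<in> set cs. tdist c l \<le> 2"
  shows "cops_win T (length cs)"
  using legal_chase[OF assms(1)] chase_captures[OF assms] unfolding cops_win_def by blast

lemma winning_strategy_dominates:
  assumes legal: "legal_cop_strategy T k \<sigma>"
    and win: "\<And>x. robber_trajectory T x \<Longrightarrow> captured \<sigma> x" and l: "l \<in> leaves T"
  shows "\<exists>c \<in> set (\<sigma> []). tdist c l \<le> 2"
proof (rule ccontr)
  assume far: "\<not> (\<exists>c \<in> set (\<sigma> []). tdist c l \<le> 2)"
  have lV: "l \<in> pverts T" using l by (simp add: leaves_iff)
  have \<sigma>V: "set (\<sigma> []) \<subseteq> pverts T" using legal by (simp add: legal_cop_strategy_def)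
  define p where "p = (if \<exists>p. (l, p) \<in> parcs T then SOME p. (l, p) \<in> parcs T else l)"
  have p: "(l, p) \<in> parcs T \<or> p = l" "(l, z) \<in> parcs T \<Longrightarrow> z = p" for z
    using someI_ex[of "\<lambda>p. (l, p) \<in> parcs T"] l by (auto simp: p_def leaves_iff)
  have pV: "p \<in> pverts T" using p(1) lV by (auto dest: in_arcsD2)
  define x where "x = (\<lambda>t::nat. if t = 0 then p else l)"
  have isolated: "(c, l) \<notin> parcs (remaining T x (Suc t))" for c t
  proof
    assume c: "(c, l) \<in> parcs (remaining T x (Suc t))"
    then have "(c, l) \<in> parcs T" using parcs_remaining_subset by blast
    then have "c = p" using p(2) arcs_symmetric by blast
    moreover have "(x 0, x (Suc 0)) \<notin> parcs (remaining T x (Suc t))"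
      by (auto simp: remaining_def)
    ultimately show False using c by (simp add: x_def)
  qed
  have x: "robber_trajectory T x"
    unfolding robber_trajectory_def using p(1) pV
    by (auto simp: x_def may_move_def remaining_def intro: arcs_symmetric)
  have moves: "\<exists>c \<in> set (cops_at \<sigma> x t). may_move (remaining T x t) c c'"
    if "c' \<in> set (cops_at \<sigma> x (Suc t))" for t c'
  proof -
    have "list_all2 (may_move (remaining T x t)) (cops_at \<sigma> x t) (cops_at \<sigma> x (Suc t))"
      using legal x by (simp add: legal_cop_strategy_def)
    then show ?thesis
      using that by (metis in_set_conv_nth list_all2_conv_all_nth)
  qed
  have init: "cops_at \<sigma> x 0 = \<sigma> []" by (simp add: cops_at_def)
  have lp: "tdist p l \<le> 1"
    using p(1) arc_iff_tdist[OF pV lV] arcs_symmetric[of l p] lV by auto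
  have far1: "2 \<le> tdist c p" "3 \<le> tdist c l" if "c \<in> set (\<sigma> [])" for c
    using that far \<sigma>V tdist_triangle[of c p l] lp pV lV by force+
  have far2: "c \<noteq> p \<and> c \<noteq> l" if c: "c \<in> set (cops_at \<sigma> x (Suc 0))" for c
  proof -
    obtain b where b: "b \<in> set (\<sigma> [])" "may_move T b c"
      using moves[OF c] init by auto
    then have bV: "b \<in> pverts T" using \<sigma>V by blast
    have cV: "c \<in> pverts T" using b(2) bV by (auto simp: may_move_def dest: in_arcsD2)
    have "tdist b c \<le> 1"
      using b(2) bV cV arc_iff_tdist[OF bV cV] by (auto simp: may_move_def)
    with far1[OF b(1)] show ?thesis by auto
  qed
  have "l \<notin> set (cops_at \<sigma> x (Suc t))" for t
  proof (induction t)
    case (Suc t)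
    show ?case
    proof
      assume "l \<in> set (cops_at \<sigma> x (Suc (Suc t)))"
      then obtain c where "c \<in> set (cops_at \<sigma> x (Suc t))" "may_move (remaining T x (Suc t)) c l"
        using moves by blast
      with Suc isolated show False by (auto simp: may_move_def)
    qed
  qed (use far2 in blast)
  moreover have "p \<notin> set (cops_at \<sigma> x 0)"
    using far1(1)[of p] pV init by auto
  ultimately have "x t \<notin> set (cops_at \<sigma> x t) \<and> x t \<notin> set (cops_at \<sigma> x (Suc t))" for t
    using far2 by (cases t) (auto simp: x_def)
  then have "\<not> captured \<sigma> x"
    by (simp add: captured_def)
  with win[OF x] show False by simp
qed

section \<open>The cop number\<close>

lemma grandparentD:
  assumes V: "r \<in> pverts T" "v \<in> pverts T" and "grandparent T r v g"
  shows "g \<in> pverts T \<and> tdist v g = 2 \<and> tdist v r = 2 + tdist g r"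
proof -
  obtain p where p: "apath v p r" "g \<in> set (pawalk_verts v p)" "tdist v g = 2"
    using assms(3) by (auto simp: grandparent_def)
  obtain q s where qs: "p = q @ s" "awalk v q g" "awalk g s r"
    using awalk_decomp[OF awalkI_apath[OF p(1)] p(2)] by auto
  have gV: "g \<in> pverts T"
    using qs(3) by (auto simp: awalk_def)
  have "length p = tdist v r"
    using p(1) apath_iff_tpath[OF V(2,1)] length_tpath[OF V(2,1)] by simp
  then have "tdist v g + tdist g r \<le> tdist v r"
    using tdist_le[OF qs(2)] tdist_le[OF qs(3)] qs(1) by simp
  then show ?thesis
    using tdist_triangle[OF V(2) gV V(1)] p(3) gV by simp
qed

lemma grandparentI:
  assumes r: "r \<in> pverts T" and va: "(a, v) \<in> parcs T" "tdist r v = Suc (tdist r a)"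
    and ab: "(b, a) \<in> parcs T" "tdist r a = Suc (tdist r b)"
  shows "grandparent T r v b"
proof -
  have V: "v \<in> pverts T" "a \<in> pverts T" "b \<in> pverts T"
    using va(1) ab(1) by (auto dest: wellformed')
  have "tpath r v = tpath r a @ [(a, v)]" "tpath r a = tpath r b @ [(b, a)]"
    using tpath_arc[OF r va(1)] tpath_arc[OF r ab(1)] va(2) ab(2) length_tpath[OF r] V
    by (metis length_append_singleton n_not_Suc_n Suc_n_not_le_n lessI less_imp_le_nat)+
  then have "(b, a) \<in> set (tpath r v)" by simp
  then have b: "b \<in> set (pawalk_verts r (tpath r v))"
    using awalk_verts_arc1[of "(b, a)" "tpath r v" r] by simp
  have ap: "apath r (tpath r v) v"
    using apath_iff_tpath[OF r V(1)] by simp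
  then have "b \<in> set (pawalk_verts v (rev_path (tpath r v)))"
    using b awalk_verts_rev_path[OF awalkI_apath[OF ap]] by simp
  moreover have "tdist v b = 2"
  proof -
    have "tdist a v = 1" "tdist b a = 1"
      using va(1) ab(1) arc_iff_tdist V by simp_all
    then have "tdist b v \<le> 2" "tdist r v \<le> tdist r b + tdist b v"
      using tdist_triangle[of b a v] tdist_triangle[of r b v] V r by simp_all
    then have "tdist b v = 2" using va(2) ab(2) by linarith
    then show ?thesis using tdist_commute V by simp
  qed
  moreover have "apath v (rev_path (tpath r v)) r"
    using ap by simp
  ultimately show ?thesis
    unfolding grandparent_def by blast
qed

lemma cop_site_cases:
  assumes "r \<in> pverts T" "v \<in> pverts T" "cop_site T r v c"
  shows "c \<in> pverts T" "tdist c v \<le> 2"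
    "c = r \<and> tdist v r \<le> 1 \<or> tdist v c = 2 \<and> tdist v r = 2 + tdist c r"
proof -
  consider "c = r" "v = r \<or> (v, r) \<in> parcs T" | "grandparent T r v c"
    using assms(3) by (auto simp: cop_site_def split: if_splits)
  then have *: "c \<in> pverts T \<and> (c = r \<and> tdist v r \<le> 1 \<or> tdist v c = 2 \<and> tdist v r = 2 + tdist c r)"
  proof cases
    case 1
    then show ?thesis using assms arc_iff_tdist[of v r] by auto
  next
    case 2
    then show ?thesis using grandparentD[OF assms(1,2)] by simp
  qed
  then show "c \<in> pverts T" by blast
  show "c = r \<and> tdist v r \<le> 1 \<or> tdist v c = 2 \<and> tdist v r = 2 + tdist c r"
    using * by blast
  show "tdist c v \<le> 2"
    using * tdist_commute[of c v] assms(2) by auto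
qed

lemma cop_site_iterated_parent:
  assumes r: "r \<in> pverts T" and v: "v \<in> pverts T"
    and up_root: "up r = r"
    and up: "\<And>u. u \<in> pverts T \<Longrightarrow> u \<noteq> r \<Longrightarrow> (up u, u) \<in> parcs T \<and> tdist r u = Suc (tdist r (up u))"
  shows "cop_site T r v (up (up v))"
proof -
  consider "v = r" | "v \<noteq> r" "up v = r" | "v \<noteq> r" "up v \<noteq> r" by blast
  then show ?thesis
  proof cases
    case 1
    then show ?thesis by (simp add: cop_site_def up_root)
  next
    case 2
    then have "(v, r) \<in> parcs T" using up[OF v] arcs_symmetric by auto
    then show ?thesis using 2 by (simp add: cop_site_def up_root)
  next
    case 3
    have upV: "up v \<in> pverts T" using up[OF v 3(1)] by (auto dest: in_arcsD1)
    have g: "grandparent T r v (up (up v))"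
      using grandparentI[OF r] up[OF v 3(1)] up[OF upV 3(2)] by blast
    have "tdist r v \<ge> 2"
      using up[OF v 3(1)] up[OF upV 3(2)] by simp
    then have "(v, r) \<notin> parcs T"
      using arc_iff_tdist[OF v r] tdist_commute[OF v r] by auto
    then show ?thesis using 3(1) g by (simp add: cop_site_def)
  qed
qed

lemma ex_cop_site:
  assumes "r \<in> pverts T" "v \<in> pverts T"
  shows "\<exists>c. cop_site T r v c"
proof -
  have "\<exists>w. (w, u) \<in> parcs T \<and> tdist r u = Suc (tdist r w)" if "u \<in> pverts T" "u \<noteq> r" for u
    using ex_nearer_neighbor'[OF assms(1) that(1)] that(2) by blast
  then obtain up where "\<And>u. u \<in> pverts T \<Longrightarrow> u \<noteq> r \<Longrightarrow> (up u, u) \<in> parcs T \<and> tdist r u = Suc (tdist r (up u))"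
    by metis
  then have "cop_site T r v ((up(r := r)) ((up(r := r)) v))"
    by (intro cop_site_iterated_parent[OF assms]) auto
  then show ?thesis by blast
qed

lemma cop_site_separates:
  assumes V: "r \<in> pverts T" "v \<in> pverts T" "u \<in> pverts T" and site: "cop_site T r v c"
    and nearer: "tdist u r \<le> tdist v r" and far: "\<not> tdist c u \<le> 2"
  shows "5 \<le> tdist v u"
proof -
  have cV: "c \<in> pverts T" by (rule cop_site_cases(1)[OF V(1,2) site])
  have ru: "tdist u r = tdist r u" "tdist u c = tdist c u" "tdist c r = tdist r c"
    using tdist_commute V cV by auto
  have c: "c \<noteq> r \<or> \<not> tdist v r \<le> 1"
    using nearer far ru by auto
  have "tdist v r + tdist u c \<le> max (tdist v u + tdist r c) (tdist v c + tdist r u)"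
    by (rule four_point) (use V cV in auto)
  then show ?thesis
    using cop_site_cases(3)[OF V(1,2) site] c nearer far ru by linarith
qed

lemma unguarded_leaves_snoc:
  "unguarded_leaves T (cs @ [c]) = {u \<in> unguarded_leaves T cs. \<not> tdist c u \<le> 2}"
  by (auto simp: unguarded_leaves_def)

lemma unguarded_leaves_verts: "unguarded_leaves T cs \<subseteq> pverts T"
  by (auto simp: unguarded_leaves_def leaves_def)

lemma finite_unguarded_leaves: "finite (unguarded_leaves T cs)"
  using unguarded_leaves_verts pair_finite_verts by (rule finite_subset)

lemma placement_step_decreases:
  assumes r: "r \<in> pverts T" and step: "placement_step T r cs cs'"
  shows "unguarded_leaves T cs' \<subset> unguarded_leaves T cs"
proof -
  obtain v c where v: "v \<in> unguarded_leaves T cs" "cop_site T r v c" "cs' = cs @ [c]"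
    using step by (auto simp: placement_step_def)
  have "tdist c v \<le> 2"
    using cop_site_cases(2)[OF r _ v(2)] v(1) unguarded_leaves_verts by blast
  then show ?thesis
    using v by (auto simp: unguarded_leaves_snoc)
qed

lemma no_infinite_placement:
  assumes "r \<in> pverts T"
  shows "\<nexists>run. run 0 = [] \<and> (\<forall>i. placement_step T r (run i) (run (Suc i)))"
proof
  assume "\<exists>run. run 0 = [] \<and> (\<forall>i. placement_step T r (run i) (run (Suc i)))"
  then obtain run where run: "\<And>i. placement_step T r (run i) (run (Suc i))" by blast
  have "card (unguarded_leaves T (run (Suc i))) < card (unguarded_leaves T (run i))" for i
    by (rule psubset_card_mono[OF finite_unguarded_leaves placement_step_decreases[OF assms run]])
  then show False
    using wf_no_infinite_down_chainE[OF wf_less_than, of "\<lambda>i. card (unguarded_leaves T (run i))"]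
    by auto
qed

lemma ex_placement_step:
  assumes "r \<in> pverts T" "unguarded_leaves T cs \<noteq> {}"
  shows "\<exists>cs'. placement_step T r cs cs'"
proof -
  let ?U = "unguarded_leaves T cs"
  have "Max ((\<lambda>u. tdist u r) ` ?U) \<in> (\<lambda>u. tdist u r) ` ?U"
    using finite_unguarded_leaves assms(2) by (intro Max_in) auto
  then obtain v where v: "v \<in> ?U" "tdist v r = Max ((\<lambda>u. tdist u r) ` ?U)" by auto
  then have "\<forall>u \<in> ?U. tdist u r \<le> tdist v r"
    using finite_unguarded_leaves by simp
  moreover obtain c where "cop_site T r v c"
    using ex_cop_site[OF assms(1)] v(1) unguarded_leaves_verts by blast
  ultimately show ?thesis
    using v(1) unfolding placement_step_def by blast
qed

lemma placement_terminates:
  assumes "r \<in> pverts T"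
  shows "\<exists>cs. placement_result T r cs"
proof -
  have "\<exists>cs'. (placement_step T r)\<^sup>*\<^sup>* cs cs' \<and> unguarded_leaves T cs' = {}" for cs
  proof (induction "card (unguarded_leaves T cs)" arbitrary: cs rule: less_induct)
    case less
    show ?case
    proof (cases "unguarded_leaves T cs = {}")
      case False
      then obtain cs' where s: "placement_step T r cs cs'"
        using ex_placement_step[OF assms] by blast
      then have "card (unguarded_leaves T cs') < card (unguarded_leaves T cs)"
        by (rule psubset_card_mono[OF finite_unguarded_leaves placement_step_decreases[OF assms]])
      with less s show ?thesis by (meson converse_rtranclp_into_rtranclp)
    qed blast
  qed
  then show ?thesis by (auto simp: placement_result_def)
qed

lemma placement_packing:
  assumes r: "r \<in> pverts T" and run: "(placement_step T r)\<^sup>*\<^sup>* [] cs"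
  shows "set cs \<subseteq> pverts T \<and>
    (\<exists>vs. length vs = length cs \<and> set vs \<subseteq> leaves T \<and> distinct vs \<and>
      pairwise (\<lambda>u v. 5 \<le> tdist u v) (set vs) \<and>
      (\<forall>v \<in> set vs. \<exists>c \<in> set cs. cop_site T r v c \<and>
        (\<forall>u \<in> unguarded_leaves T cs. tdist u r \<le> tdist v r)))"
  using run
proof (induction rule: rtranclp_induct)
  case base
  show ?case by simp
next
  case (step cs cs')
  obtain v c where v: "v \<in> unguarded_leaves T cs" "cop_site T r v c" "cs' = cs @ [c]"
    and far: "\<forall>u \<in> unguarded_leaves T cs. tdist u r \<le> tdist v r"
    using step.hyps(2) by (auto simp: placement_step_def)
  have vV: "v \<in> pverts T" using v(1) unguarded_leaves_verts by blast
  obtain vs where vs: "length vs = length cs" "set vs \<subseteq> leaves T" "distinct vs"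
      "pairwise (\<lambda>u v. 5 \<le> tdist u v) (set vs)"
    and sites: "\<And>w. w \<in> set vs \<Longrightarrow> \<exists>c \<in> set cs. cop_site T r w c \<and>
        (\<forall>u \<in> unguarded_leaves T cs. tdist u r \<le> tdist w r)"
    using step.IH by blast
  have sep: "5 \<le> tdist w v" if "w \<in> set vs" for w
  proof -
    obtain d where d: "d \<in> set cs" "cop_site T r w d" "tdist v r \<le> tdist w r"
      using sites[OF \<open>w \<in> set vs\<close>] v(1) by blast
    have "\<not> tdist d v \<le> 2"
      using v(1) d(1) by (auto simp: unguarded_leaves_def)
    moreover have "w \<in> pverts T"
      using that vs(2) by (auto simp: leaves_iff)
    ultimately show ?thesis
      using cop_site_separates[OF r _ vV d(2,3)] by blast
  qed
  have "v \<notin> set vs" using sep[of v] vV by auto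
  moreover have "5 \<le> tdist v w" if "w \<in> set vs" for w
    using sep[OF that] tdist_commute[OF vV, of w] that vs(2) by (auto simp: leaves_iff)
  moreover have "c \<in> pverts T" by (rule cop_site_cases(1)[OF r vV v(2)])
  moreover have "v \<in> leaves T" using v(1) by (simp add: unguarded_leaves_def)
  moreover have "\<exists>c \<in> set cs'. cop_site T r w c \<and> (\<forall>u \<in> unguarded_leaves T cs'. tdist u r \<le> tdist w r)"
    if "w \<in> insert v (set vs)" for w
    using that sites[of w] v(2,3) far unguarded_leaves_snoc[of cs c] by auto
  ultimately show ?case
    using step.IH vs sep v(3)
    by (intro conjI exI[of _ "v # vs"]) (simp_all add: pairwise_insert)
qed

theorem cop_number_placement:
  assumes r: "r \<in> pverts T" and res: "placement_result T r cs"
  shows "bridge_burning_cop_number T = length cs"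
proof -
  have run: "(placement_step T r)\<^sup>*\<^sup>* [] cs" and "unguarded_leaves T cs = {}"
    using res by (simp_all add: placement_result_def)
  obtain vs where csV: "set cs \<subseteq> pverts T" and vs: "length vs = length cs" "set vs \<subseteq> leaves T"
      "distinct vs" "pairwise (\<lambda>u v. 5 \<le> tdist u v) (set vs)"
    using placement_packing[OF r run] by blast
  have "cops_win T (length cs)"
    by (rule cops_win_if_dominating[OF csV])
      (use \<open>unguarded_leaves T cs = {}\<close> in \<open>auto simp: unguarded_leaves_def\<close>)
  moreover have "length cs \<le> k" if "cops_win T k" for k
  proof -
    obtain \<sigma> where \<sigma>: "legal_cop_strategy T k \<sigma>" "\<And>x. robber_trajectory T x \<Longrightarrow> captured \<sigma> x"
      using \<open>cops_win T k\<close> unfolding cops_win_def by blast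
    have \<sigma>V: "set (\<sigma> []) \<subseteq> pverts T" and len: "length (\<sigma> []) = k"
      using \<sigma>(1) by (simp_all add: legal_cop_strategy_def)
    have "\<exists>c \<in> set (\<sigma> []). tdist c v \<le> 2" if "v \<in> set vs" for v
      using winning_strategy_dominates[OF \<sigma>] vs(2) that by blast
    then obtain f where f: "\<And>v. v \<in> set vs \<Longrightarrow> f v \<in> set (\<sigma> []) \<and> tdist (f v) v \<le> 2"
      by metis
    have "inj_on f (set vs)"
    proof (rule inj_onI, rule ccontr)
      fix u v assume uv: "u \<in> set vs" "v \<in> set vs" "f u = f v" "u \<noteq> v"
      have V: "u \<in> pverts T" "v \<in> pverts T" "f u \<in> pverts T"
        using uv vs(2) f[OF uv(1)] \<sigma>V by (auto simp: leaves_iff)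
      have "tdist u v \<le> tdist u (f u) + tdist (f u) v"
        by (rule tdist_triangle) (use V in auto)
      moreover have "5 \<le> tdist u v"
        using vs(4) uv by (auto simp: pairwise_def)
      ultimately show False
        using f[OF uv(1)] f[OF uv(2)] uv(3) tdist_commute[OF V(1,3)] by simp
    qed
    then have "card (set vs) \<le> card (set (\<sigma> []))"
      by (rule card_inj_on_le) (use f in auto)
    also have "\<dots> \<le> length (\<sigma> [])" by (rule card_length)
    finally show ?thesis
      using distinct_card[OF vs(3)] vs(1) len by simp
  qed
  ultimately show ?thesis
    unfolding bridge_burning_cop_number_def by (rule Least_equality)
qed

end

section \<open>Running times of programs\<close>

definition runs :: "prog \<Rightarrow> store \<Rightarrow> nat \<Rightarrow> (store \<Rightarrow> bool) \<Rightarrow> bool" where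
  "runs P s b Q \<longleftrightarrow> (\<exists>t s'. exec P s t s' \<and> t \<le> b \<and> Q s')"

lemma runs_mono:
  assumes "runs P s b Q" "b \<le> b'" "\<And>s'. Q s' \<Longrightarrow> Q' s'"
  shows "runs P s b' Q'"
proof -
  obtain t s' where "exec P s t s'" "t \<le> b" "Q s'"
    using assms(1) by (auto simp: runs_def)
  then show ?thesis
    using assms(2,3) le_trans unfolding runs_def by blast
qed

lemma runs_Seq:
  assumes "runs P s b (\<lambda>s'. runs P' s' b' Q)" "b + b' + 1 \<le> c"
  shows "runs (Seq P P') s c Q"
proof -
  obtain t s' t' s'' where "exec P s t s'" "t \<le> b" "exec P' s' t' s''" "t' \<le> b'" "Q s''"
    using assms(1) by (auto simp: runs_def)
  then show ?thesis
    using exec.Seq[of P s t s' P' t' s''] assms(2) unfolding runs_def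
    by (intro exI[of _ "t + t' + 1"] exI[of _ s'']) simp
qed

primrec loop_free :: "prog \<Rightarrow> bool" where
  "loop_free Skip = True"
| "loop_free (Assign a e f) = True"
| "loop_free (Seq P Q) = (loop_free P \<and> loop_free Q)"
| "loop_free (IfLess e f P Q) = (loop_free P \<and> loop_free Q)"
| "loop_free (WhileLess e f P) = False"

text \<open>\<open>eff\<close> and \<open>max_cost\<close> are meaningful for loop-free programs only.\<close>

primrec eff :: "prog \<Rightarrow> store \<Rightarrow> store" where
  "eff Skip s = s"
| "eff (Assign a e f) s = update s a (val s e) (val s f)"
| "eff (Seq P Q) s = eff Q (eff P s)"
| "eff (IfLess e f P Q) s = (if val s e < val s f then eff P s else eff Q s)"
| "eff (WhileLess e f P) s = s"

primrec max_cost :: "prog \<Rightarrow> nat" where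
  "max_cost Skip = 1"
| "max_cost (Assign a e f) = cost e + cost f + 1"
| "max_cost (Seq P Q) = max_cost P + max_cost Q + 1"
| "max_cost (IfLess e f P Q) = cost e + cost f + max (max_cost P) (max_cost Q) + 1"
| "max_cost (WhileLess e f P) = 0"

lemma exec_loop_free: "loop_free P \<Longrightarrow> \<exists>t \<le> max_cost P. exec P s t (eff P s)"
proof (induction P arbitrary: s)
  case (Seq P Q)
  then obtain t u where "t \<le> max_cost P" "exec P s t (eff P s)" "u \<le> max_cost Q"
      "exec Q (eff P s) u (eff Q (eff P s))"
    by (metis loop_free.simps(3))
  then show ?case
    using exec.Seq[of P s t "eff P s" Q u] by (intro exI[of _ "t + u + 1"]) simp
next
  case (IfLess e f P Q)
  obtain t where t: "t \<le> max_cost P" "exec P s t (eff P s)"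
    using IfLess by (metis loop_free.simps(4))
  obtain u where u: "u \<le> max_cost Q" "exec Q s u (eff Q s)"
    using IfLess by (metis loop_free.simps(4))
  show ?case
  proof (cases "val s e < val s f")
    case True
    then show ?thesis
      using exec.IfTrue[OF True t(2), of Q] t(1) by (intro exI[of _ "cost e + cost f + t + 1"]) simp
  next
    case False
    then show ?thesis
      using exec.IfFalse[OF False u(2), of P] u(1) by (intro exI[of _ "cost e + cost f + u + 1"]) simp
  qed
qed (use exec.Skip exec.Assign in auto)

lemma runs_loop_free:
  assumes "loop_free P" "Q (eff P s)" "max_cost P \<le> b"
  shows "runs P s b Q"
  using exec_loop_free[OF assms(1), of s] assms(2,3) le_trans unfolding runs_def by blast

lemma runs_Assign_Seq:
  assumes "runs P (update s a (val s e) (val s f)) b Q" "cost e + cost f + 1 + b + 1 \<le> c"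
  shows "runs (Seq (Assign a e f) P) s c Q"
proof (rule runs_Seq)
  show "runs (Assign a e f) s (cost e + cost f + 1) (\<lambda>s'. runs P s' b Q)"
    by (rule runs_loop_free) (simp_all add: assms(1))
qed (rule assms(2))

abbreviation scalar :: "string \<Rightarrow> expr" where
  "scalar a \<equiv> Cell a (Num 0)"

definition For :: "string \<Rightarrow> expr \<Rightarrow> prog \<Rightarrow> prog" where
  "For i N P = Seq (Assign i (Num 0) (Num 0))
     (WhileLess (scalar i) N (Seq P (Assign i (Num 0) (Plus (scalar i) (Num 1)))))"

lemma runs_For:
  assumes init: "I 0 (update s i 0 0)"
    and inv: "\<And>k s'. I k s' \<Longrightarrow> k \<le> n \<Longrightarrow> s' i 0 = k \<and> val s' N = n"
    and body: "\<And>k s'. I k s' \<Longrightarrow> k < n \<Longrightarrow>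
      runs P s' b (\<lambda>s''. s'' i 0 = k \<and> I (Suc k) (update s'' i 0 (Suc k)))"
    and bound: "n \<le> n'" "n' * (b + cost N + 10) + cost N + 7 \<le> c"
  shows "runs (For i N P) s c (I n)"
proof -
  let ?W = "WhileLess (scalar i) N (Seq P (Assign i (Num 0) (Plus (scalar i) (Num 1))))"
  have loop: "runs ?W s' ((n - k) * (b + cost N + 10) + cost N + 3) (I n)" if "I k s'" "k \<le> n" for k s'
    using that
  proof (induction "n - k" arbitrary: k s')
    case 0
    then have "\<not> val s' (scalar i) < val s' N" "I n s'"
      using inv[of k s'] by auto
    then have "exec ?W s' (cost (scalar i) + cost N + 1) s'"
      by (intro exec.WhileFalse)
    then show ?case
      unfolding runs_def using \<open>I n s'\<close>
      by (intro exI[of _ "cost (scalar i) + cost N + 1"] exI[of _ s']) simp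
  next
    case (Suc d)
    then have less: "val s' (scalar i) < val s' N" and k: "k < n" "d = n - Suc k"
      using inv[of k s'] by auto
    obtain t s'' where t: "exec P s' t s''" "t \<le> b" "s'' i 0 = k" "I (Suc k) (update s'' i 0 (Suc k))"
      using body[OF Suc.prems(1) k(1)] by (auto simp: runs_def)
    let ?A = "Assign i (Num 0) (Plus (scalar i) (Num 1))"
    have A: "exec ?A s'' 6 (update s'' i 0 (Suc k))"
      using exec.Assign[of i "Num 0" "Plus (scalar i) (Num 1)" s''] t(3)
      by (simp add: numeral_eq_Suc)
    obtain u s3 where u: "exec ?W (update s'' i 0 (Suc k)) u s3"
        "u \<le> (n - Suc k) * (b + cost N + 10) + cost N + 3" "I n s3"
      using Suc.hyps(1)[OF k(2) t(4)] k(1) by (auto simp: runs_def)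
    have "exec ?W s' (cost (scalar i) + cost N + (t + 6 + 1) + u + 1) s3"
      by (rule exec.WhileTrue[OF less exec.Seq[OF t(1) A] u(1)])
    moreover have "n - k = Suc (n - Suc k)" using k(1) by simp
    then have "cost (scalar i) + cost N + (t + 6 + 1) + u + 1 \<le> (n - k) * (b + cost N + 10) + cost N + 3"
      using u(2) t(2) by simp
    ultimately show ?case
      unfolding runs_def using u(3) by (intro exI conjI)
  qed
  have "n * (b + cost N + 10) \<le> n' * (b + cost N + 10)"
    using bound(1) by (rule mult_le_mono1)
  then have "3 + (n * (b + cost N + 10) + cost N + 3) + 1 \<le> c"
    using bound(2) by linarith
  then show ?thesis
    unfolding For_def
    by (intro runs_Assign_Seq[where b = "n * (b + cost N + 10) + cost N + 3"])
      (use loop[OF init] in simp_all)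
qed

definition polynomially_bounded :: "(nat \<Rightarrow> nat) \<Rightarrow> bool" where
  "polynomially_bounded f \<longleftrightarrow> (\<exists>q. \<forall>n. f n = poly q n)"

lemma polynomially_bounded_intros:
  "polynomially_bounded (\<lambda>n. c)"
  "polynomially_bounded (\<lambda>n. n)"
  "polynomially_bounded f \<Longrightarrow> polynomially_bounded g \<Longrightarrow> polynomially_bounded (\<lambda>n. f n + g n)"
  "polynomially_bounded f \<Longrightarrow> polynomially_bounded g \<Longrightarrow> polynomially_bounded (\<lambda>n. f n * g n)"
proof -
  show "polynomially_bounded (\<lambda>n. c)"
    unfolding polynomially_bounded_def by (rule exI[of _ "[:c:]"]) simp
  show "polynomially_bounded (\<lambda>n. n)"
    unfolding polynomially_bounded_def by (rule exI[of _ "[:0, 1:]"]) simp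
  assume "polynomially_bounded f" "polynomially_bounded g"
  then obtain p q where "\<And>n. f n = poly p n" "\<And>n. g n = poly q n"
    unfolding polynomially_bounded_def by blast
  then have "\<forall>n. f n + g n = poly (p + q) n" "\<forall>n. f n * g n = poly (p * q) n"
    by simp_all
  then show "polynomially_bounded (\<lambda>n. f n + g n)" "polynomially_bounded (\<lambda>n. f n * g n)"
    unfolding polynomially_bounded_def by blast+
qed

section \<open>The placement program\<close>

abbreviation source :: expr where "source \<equiv> Cell ''src'' (scalar ''j'')"
abbreviation target :: expr where "target \<equiv> Cell ''dst'' (scalar ''j'')"

definition raise :: "string \<Rightarrow> expr \<Rightarrow> expr \<Rightarrow> prog" where
  "raise A x y = IfLess (Cell A y) (Minus (Cell A x) (Num 1))
     (Assign A y (Minus (Cell A x) (Num 1))) Skip"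

definition relax_edge :: "string \<Rightarrow> prog" where
  "relax_edge A = Seq (raise A source target) (raise A target source)"

definition relax :: "string \<Rightarrow> prog" where
  "relax A = For ''i'' (scalar ''n'') (For ''j'' (scalar ''m'') (relax_edge A))"

definition link_edge :: prog where
  "link_edge = Seq (Assign ''deg'' source (Plus (Cell ''deg'' source) (Num 1)))
     (Seq (Assign ''deg'' target (Plus (Cell ''deg'' target) (Num 1)))
     (IfLess (Cell ''h'' source) (Cell ''h'' target)
        (Assign ''up'' source target) (Assign ''up'' target source)))"

text \<open>
  \<open>key\<close> is 1 plus the distance from the root of the farthest unguarded leaf \<open>best\<close> found so far, and 0 if
  there is none.
\<close>

definition inspect_vertex :: prog where
  "inspect_vertex = IfLess (Cell ''deg'' (scalar ''j'')) (Num 2)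
     (IfLess (Cell ''g'' (scalar ''j'')) (Num 1)
       (IfLess (scalar ''key'') (Minus (Plus (scalar ''n'') (Num 1)) (Cell ''h'' (scalar ''j'')))
         (Seq (Assign ''key'' (Num 0) (Minus (Plus (scalar ''n'') (Num 1)) (Cell ''h'' (scalar ''j''))))
           (Assign ''best'' (Num 0) (scalar ''j'')))
         Skip) Skip) Skip"

text \<open>As the root is its own parent, the second iterate of \<open>up\<close> is the cop site in all cases.\<close>

abbreviation site :: expr where "site \<equiv> Cell ''up'' (Cell ''up'' (scalar ''best''))"

definition put_cop :: prog where
  "put_cop = IfLess (Num 0) (scalar ''key'')
     (Seq (Assign ''cop'' (scalar ''count'') site)
     (Seq (Assign ''g'' site (Num 3))
       (Assign ''count'' (Num 0) (Plus (scalar ''count'') (Num 1))))) Skip"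

definition place_cop :: prog where
  "place_cop = Seq (Assign ''key'' (Num 0) (Num 0))
     (Seq (For ''j'' (scalar ''n'') inspect_vertex) (Seq put_cop (relax ''g'')))"

definition placement_prog :: prog where
  "placement_prog =
     Seq (Assign ''h'' (scalar ''root'') (scalar ''n''))
     (Seq (relax ''h'')
     (Seq (Assign ''up'' (scalar ''root'') (scalar ''root''))
     (Seq (For ''j'' (scalar ''m'') link_edge)
       (For ''k'' (scalar ''n'') place_cop))))"

definition pass_cost :: "nat \<Rightarrow> nat" where
  "pass_cost N = N * N * 55 + 9"

definition relax_cost :: "nat \<Rightarrow> nat" where
  "relax_cost N = N * (pass_cost N + 12) + 9"

definition link_cost :: "nat \<Rightarrow> nat" where
  "link_cost N = N * N * (max_cost link_edge + 12) + 9"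

definition scan_cost :: "nat \<Rightarrow> nat" where
  "scan_cost N = N * (max_cost inspect_vertex + 12) + 9"

definition place_cost :: "nat \<Rightarrow> nat" where
  "place_cost N = 3 + (scan_cost N + (max_cost put_cop + relax_cost N + 1) + 1) + 1"

definition main_cost :: "nat \<Rightarrow> nat" where
  "main_cost N = N * (place_cost N + 12) + 9"

definition total_cost :: "nat \<Rightarrow> nat" where
  "total_cost N = 5 + (relax_cost N + (5 + (link_cost N + main_cost N + 1) + 1) + 1) + 1"

lemma polynomially_bounded_total_cost: "polynomially_bounded total_cost"
  unfolding total_cost_def[abs_def] main_cost_def place_cost_def scan_cost_def link_cost_def
    relax_cost_def pass_cost_def
  by (intro polynomially_bounded_intros)

definition raised :: "nat \<Rightarrow> nat \<Rightarrow> (nat \<Rightarrow> nat) \<Rightarrow> nat \<Rightarrow> nat" where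
  "raised a b f = f(b := max (f b) (f a - 1))"

lemma eff_raise: "eff (raise A x y) s = s(A := raised (val s x) (val s y) (s A))"
  by (simp add: raise_def update_def raised_def max_def)

lemma eff_relax_edge:
  assumes "A \<noteq> ''src''" "A \<noteq> ''dst''" "A \<noteq> ''j''"
  shows "eff (relax_edge A) s =
    s(A := raised (s ''dst'' (s ''j'' 0)) (s ''src'' (s ''j'' 0))
            (raised (s ''src'' (s ''j'' 0)) (s ''dst'' (s ''j'' 0)) (s A)))"
  using assms by (simp add: relax_edge_def eff_raise)

lemma max_cost_relax_edge: "loop_free (relax_edge A)" "max_cost (relax_edge A) = 43"
  by (simp_all add: relax_edge_def raise_def)

locale tree_input = undirected_tree T for T :: "nat pair_pre_digraph" +
  fixes n :: nat and es :: "(nat \<times> nat) list"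
  assumes represents: "represents n es T"
begin

lemma pverts_T: "pverts T = {..<n}"
  using represents by (simp add: represents_def)

lemma edge_arcs:
  assumes "i < length es"
  shows "(fst (es ! i), snd (es ! i)) \<in> parcs T" "(snd (es ! i), fst (es ! i)) \<in> parcs T"
proof -
  have "(fst (es ! i), snd (es ! i)) \<in> set es"
    using assms by simp
  then show "(fst (es ! i), snd (es ! i)) \<in> parcs T" "(snd (es ! i), fst (es ! i)) \<in> parcs T"
    using represents by (auto simp: represents_def)
qed

lemma arc_edge:
  assumes "(a, b) \<in> parcs T"
  shows "\<exists>i < length es. es ! i = (a, b) \<or> es ! i = (b, a)"
proof -
  have "(a, b) \<in> set es \<or> (b, a) \<in> set es"
    using assms represents by (auto simp: represents_def)
  then show ?thesis by (metis in_set_conv_nth)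
qed

lemma length_es: "length es \<le> n * n"
proof -
  have "set es \<subseteq> {..<n} \<times> {..<n}"
  proof
    fix e assume "e \<in> set es"
    then have "e \<in> parcs T" using represents by (simp add: represents_def)
    then show "e \<in> {..<n} \<times> {..<n}"
      using arc_fst_in_verts[of e] arc_snd_in_verts[of e] pverts_T by (cases e) auto
  qed
  then have "card (set es) \<le> card ({..<n} \<times> {..<n})"
    by (intro card_mono) auto
  then show ?thesis
    using represents distinct_card[of es] by (simp add: represents_def)
qed

lemma tdist_le_n:
  assumes "u < n" "v < n"
  shows "tdist u v < n"
proof -
  have V: "u \<in> pverts T" "v \<in> pverts T" using assms pverts_T by auto
  have ap: "apath u (tpath u v) v" using apath_iff_tpath[OF V] by simp
  have "set (pawalk_verts u (tpath u v)) \<subseteq> {..<n}"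
    using ap pverts_T unfolding apath_def by (metis awalkE')
  then have "card (set (pawalk_verts u (tpath u v))) \<le> n"
    using card_mono[of "{..<n}"] by simp
  moreover have "distinct (pawalk_verts u (tpath u v))"
    using ap by (simp add: apath_def)
  ultimately have "length (tpath u v) < n"
    using distinct_card[of "pawalk_verts u (tpath u v)"] length_awalk_verts[of u "tpath u v"] by simp
  then show ?thesis using length_tpath[OF V] by simp
qed

definition holds_input :: "store \<Rightarrow> bool" where
  "holds_input s \<longleftrightarrow> s ''n'' 0 = n \<and> s ''m'' 0 = length es \<and>
     (\<forall>i < length es. s ''src'' i = fst (es ! i) \<and> s ''dst'' i = snd (es ! i))"

text \<open>
  The goal of the relaxation is \<open>f u = max 0 (w - d)\<close> with \<open>d\<close> the distance from \<open>S\<close> to \<open>u\<close>; soundness is the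
  upper bound, and completeness the lower bound for distances up to \<open>k\<close>.
\<close>

definition reach_sound :: "nat set \<Rightarrow> nat \<Rightarrow> (nat \<Rightarrow> nat) \<Rightarrow> bool" where
  "reach_sound S w f \<longleftrightarrow> (\<forall>u<n. f u = 0 \<or> (\<exists>s \<in> S. f u + tdist s u \<le> w))"

definition reach_complete :: "nat set \<Rightarrow> nat \<Rightarrow> nat \<Rightarrow> (nat \<Rightarrow> nat) \<Rightarrow> bool" where
  "reach_complete S w k f \<longleftrightarrow> (\<forall>s \<in> S. \<forall>u<n. tdist s u \<le> k \<longrightarrow> w \<le> f u + tdist s u)"

lemma reach_sound_raised:
  assumes S: "S \<subseteq> {..<n}" and f: "reach_sound S w f" and ab: "(a, b) \<in> parcs T"
  shows "reach_sound S w (raised a b f)"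
  unfolding reach_sound_def
proof (intro allI impI)
  fix u assume u: "u < n"
  have V: "a < n" "b < n"
    using ab pverts_T by (auto dest: wellformed')
  show "raised a b f u = 0 \<or> (\<exists>s \<in> S. raised a b f u + tdist s u \<le> w)"
  proof (cases "u = b \<and> f b < f a - 1")
    case True
    then obtain s where s: "s \<in> S" "f a + tdist s a \<le> w"
      using f V unfolding reach_sound_def by (metis diff_0_eq_0 not_less_zero)
    have "s \<in> pverts T"
      using s(1) S unfolding pverts_T by blast
    then have "tdist s b \<le> Suc (tdist s a)"
      using arc_tdist_cases[OF _ ab, of s] by linarith
    moreover have "raised a b f u = f a - 1" "u = b" "f a \<noteq> 0"
      using True by (auto simp: raised_def)
    ultimately have "raised a b f u + tdist s u \<le> w"
      using s(2) by simp
    with s(1) show ?thesis by (intro disjI2 bexI)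
  next
    case False
    then have "raised a b f u = f u" by (auto simp: raised_def max_def)
    then show ?thesis using f u by (simp add: reach_sound_def)
  qed
qed

lemma raised_ge: "f u \<le> raised a b f u" "f a - 1 \<le> raised a b f b"
  by (auto simp: raised_def)

lemma reach_complete_mono:
  assumes "reach_complete S w k f" "\<And>u. f u \<le> f' u"
  shows "reach_complete S w k f'"
  using assms unfolding reach_complete_def by (meson add_le_mono1 le_trans)

definition relaxed_edges :: "nat set \<Rightarrow> nat \<Rightarrow> nat \<Rightarrow> nat \<Rightarrow> (nat \<Rightarrow> nat) \<Rightarrow> bool" where
  "relaxed_edges S w k j f \<longleftrightarrow> (\<forall>s \<in> S. \<forall>i<j.
     (tdist s (fst (es ! i)) = k \<longrightarrow> w \<le> f (snd (es ! i)) + Suc k) \<and>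
     (tdist s (snd (es ! i)) = k \<longrightarrow> w \<le> f (fst (es ! i)) + Suc k))"

lemma relaxed_edges_Suc:
  assumes f: "reach_complete S w k f" "relaxed_edges S w k j f" and j: "j < length es"
  defines "a \<equiv> fst (es ! j)" and "b \<equiv> snd (es ! j)"
  defines "f' \<equiv> raised b a (raised a b f)"
  shows "reach_complete S w k f'" "relaxed_edges S w k (Suc j) f'"
proof -
  have mono: "f u \<le> f' u" for u
    unfolding f'_def using raised_ge(1) le_trans by blast
  show "reach_complete S w k f'"
    by (rule reach_complete_mono[OF f(1) mono])
  have b: "f a - 1 \<le> f' b"
    unfolding f'_def using raised_ge le_trans by blast
  have "raised a b f b - 1 \<le> f' a" "f b \<le> raised a b f b"
    unfolding f'_def by (rule raised_ge)+
  then have a: "f b - 1 \<le> f' a" by linarith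
  have V: "a < n" "b < n"
    using edge_arcs[OF j] pverts_T by (auto simp: a_def b_def dest: wellformed')
  show "relaxed_edges S w k (Suc j) f'"
    unfolding relaxed_edges_def
  proof (intro ballI allI impI)
    fix s i assume s: "s \<in> S" and i: "i < Suc j"
    show "(tdist s (fst (es ! i)) = k \<longrightarrow> w \<le> f' (snd (es ! i)) + Suc k) \<and>
     (tdist s (snd (es ! i)) = k \<longrightarrow> w \<le> f' (fst (es ! i)) + Suc k)"
    proof (cases "i = j")
      case True
      have "tdist s a = k \<Longrightarrow> w \<le> f a + k" "tdist s b = k \<Longrightarrow> w \<le> f b + k"
        using f(1) s V unfolding reach_complete_def by auto
      then show ?thesis
        using a b True unfolding a_def b_def by auto
    next
      case False
      then have "(tdist s (fst (es ! i)) = k \<longrightarrow> w \<le> f (snd (es ! i)) + Suc k) \<and>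
     (tdist s (snd (es ! i)) = k \<longrightarrow> w \<le> f (fst (es ! i)) + Suc k)"
        using f(2) s i unfolding relaxed_edges_def by auto
      then show ?thesis
        using mono[of "fst (es ! i)"] mono[of "snd (es ! i)"] by auto
    qed
  qed
qed

lemma reach_complete_Suc:
  assumes S: "S \<subseteq> {..<n}" and f: "reach_complete S w k f" "relaxed_edges S w k (length es) f"
  shows "reach_complete S w (Suc k) f"
  unfolding reach_complete_def
proof (intro ballI allI impI)
  fix s u assume s: "s \<in> S" and u: "u < n" and d: "tdist s u \<le> Suc k"
  show "w \<le> f u + tdist s u"
  proof (cases "tdist s u \<le> k")
    case True
    then show ?thesis using f(1) s u by (simp add: reach_complete_def)
  next
    case False
    then have sk: "tdist s u = Suc k" using d by simp
    have V: "s \<in> pverts T" "u \<in> pverts T" using s S u pverts_T by auto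
    then have "s \<noteq> u" using sk by auto
    then obtain v where v: "(v, u) \<in> parcs T" "tdist s u = Suc (tdist s v)"
      using ex_nearer_neighbor'[OF V] by blast
    then obtain i where "i < length es" "es ! i = (v, u) \<or> es ! i = (u, v)"
      using arc_edge by blast
    then have "w \<le> f u + Suc k"
      using f(2) s sk v(2) unfolding relaxed_edges_def by force
    then show ?thesis using sk by simp
  qed
qed

lemma runs_relax_pass:
  assumes S: "S \<subseteq> {..<n}" and inp: "holds_input s" and A: "A \<in> {''h'', ''g''}"
    and f: "reach_sound S w (s A)" "reach_complete S w k (s A)"
  shows "runs (For ''j'' (scalar ''m'') (relax_edge A)) s (pass_cost n)
    (\<lambda>s'. reach_sound S w (s' A) \<and> reach_complete S w (Suc k) (s' A) \<and>
       (\<forall>x. x \<noteq> A \<longrightarrow> x \<noteq> ''j'' \<longrightarrow> s' x = s x))"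
proof -
  define I where "I = (\<lambda>j s'. s' ''j'' 0 = j \<and> reach_sound S w (s' A) \<and>
    reach_complete S w k (s' A) \<and> relaxed_edges S w k j (s' A) \<and>
    (\<forall>x. x \<noteq> A \<longrightarrow> x \<noteq> ''j'' \<longrightarrow> s' x = s x))"
  have A': "A \<noteq> ''j''" "A \<noteq> ''m''" "A \<noteq> ''src''" "A \<noteq> ''dst''" using A by auto
  have "runs (For ''j'' (scalar ''m'') (relax_edge A)) s (pass_cost n) (I (length es))"
  proof (rule runs_For[where b = 43 and n' = "n * n"])
    show "I 0 (update s ''j'' 0 0)"
      using f A' by (simp add: I_def update_def relaxed_edges_def)
    show "s' ''j'' 0 = j \<and> val s' (scalar ''m'') = length es" if "I j s'" "j \<le> length es" for j s'
      using that inp A' by (simp add: I_def holds_input_def)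
    fix j s' assume I: "I j s'" and j: "j < length es"
    define a b where "a = fst (es ! j)" and "b = snd (es ! j)"
    have "s' ''src'' j = a" "s' ''dst'' j = b" "s' ''j'' 0 = j"
      using I inp j A' by (simp_all add: I_def holds_input_def a_def b_def)
    then have eff: "eff (relax_edge A) s' = s'(A := raised b a (raised a b (s' A)))"
      using eff_relax_edge[of A s'] A' by simp
    have "reach_sound S w (raised b a (raised a b (s' A)))"
      using I edge_arcs[OF j] reach_sound_raised[OF S] by (simp add: I_def a_def b_def)
    moreover have "reach_complete S w k (raised b a (raised a b (s' A)))"
      "relaxed_edges S w k (Suc j) (raised b a (raised a b (s' A)))"
      using relaxed_edges_Suc[OF _ _ j] I by (simp_all add: I_def a_def b_def)
    ultimately show "runs (relax_edge A) s' 43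
        (\<lambda>s''. s'' ''j'' 0 = j \<and> I (Suc j) (update s'' ''j'' 0 (Suc j)))"
      using I A' by (intro runs_loop_free) (auto simp: max_cost_relax_edge eff I_def update_def)
  qed (simp_all add: length_es pass_cost_def)
  then show ?thesis
    by (rule runs_mono) (auto simp: I_def intro: reach_complete_Suc[OF S])
qed

lemma runs_relax:
  assumes S: "S \<subseteq> {..<n}" and inp: "holds_input s" and A: "A \<in> {''h'', ''g''}"
    and f: "reach_sound S w (s A)" "\<And>c. c \<in> S \<Longrightarrow> w \<le> s A c"
  shows "runs (relax A) s (relax_cost n)
    (\<lambda>s'. reach_sound S w (s' A) \<and> reach_complete S w n (s' A) \<and>
       (\<forall>x. x \<noteq> A \<longrightarrow> x \<noteq> ''j'' \<longrightarrow> x \<noteq> ''i'' \<longrightarrow> s' x = s x))"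
proof -
  define I where "I = (\<lambda>k s'. s' ''i'' 0 = k \<and> reach_sound S w (s' A) \<and> reach_complete S w k (s' A) \<and>
    (\<forall>x. x \<noteq> A \<longrightarrow> x \<noteq> ''j'' \<longrightarrow> x \<noteq> ''i'' \<longrightarrow> s' x = s x))"
  have A': "A \<noteq> ''i''" "A \<noteq> ''n''" "A \<noteq> ''m''" "A \<noteq> ''src''" "A \<noteq> ''dst''" using A by auto
  have start: "reach_complete S w 0 (s A)"
    unfolding reach_complete_def
  proof (intro ballI allI impI)
    fix c u assume cu: "c \<in> S" "u < n" "tdist c u \<le> 0"
    then have "c = u" using tdist_0D[of c u] S pverts_T by auto
    then show "w \<le> s A u + tdist c u" using f(2) cu by simp
  qed
  have "runs (relax A) s (relax_cost n) (I n)"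
    unfolding relax_def
  proof (rule runs_For[where b = "pass_cost n" and n' = n])
    show "I 0 (update s ''i'' 0 0)"
      using f start A' by (simp add: I_def update_def)
    show "s' ''i'' 0 = k \<and> val s' (scalar ''n'') = n" if "I k s'" "k \<le> n" for k s'
      using that inp A' by (simp add: I_def holds_input_def)
    fix k s' assume I: "I k s'" and k: "k < n"
    have "holds_input s'"
      using I inp A' by (simp add: I_def holds_input_def)
    then have "runs (For ''j'' (scalar ''m'') (relax_edge A)) s' (pass_cost n)
      (\<lambda>s''. reach_sound S w (s'' A) \<and> reach_complete S w (Suc k) (s'' A) \<and>
       (\<forall>x. x \<noteq> A \<longrightarrow> x \<noteq> ''j'' \<longrightarrow> s'' x = s' x))"
      using I by (intro runs_relax_pass[OF S _ A]) (simp_all add: I_def)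
    then show "runs (For ''j'' (scalar ''m'') (relax_edge A)) s' (pass_cost n)
        (\<lambda>s''. s'' ''i'' 0 = k \<and> I (Suc k) (update s'' ''i'' 0 (Suc k)))"
      by (rule runs_mono) (use I A' in \<open>auto simp: I_def update_def\<close>)
  qed (simp_all add: relax_cost_def)
  then show ?thesis
    by (rule runs_mono) (auto simp: I_def)
qed

lemma out_degree_count:
  "out_degree (with_proj T) u =
     length (filter (\<lambda>e. fst e = u) es) + length (filter (\<lambda>e. snd e = u) es)"
proof -
  have es: "parcs T = set es \<union> (set es)\<inverse>" "distinct es" "set es \<inter> (set es)\<inverse> = {}"
    using represents by (simp_all add: represents_def)
  let ?A = "{e \<in> set es. fst e = u}" and ?B = "{e \<in> set es. snd e = u}"
  have "out_arcs (with_proj T) u = ?A \<union> prod.swap ` ?B"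
    by (force simp: out_arcs_def es(1) image_iff)
  moreover have "?A \<inter> prod.swap ` ?B = {}"
    using es(3) by auto
  ultimately have "out_degree (with_proj T) u = card ?A + card (prod.swap ` ?B)"
    by (simp add: out_degree_def card_Un_disjoint)
  moreover have "card (prod.swap ` ?B) = card ?B"
    by (rule card_image) simp
  moreover have "card ?A = length (filter (\<lambda>e. fst e = u) es)"
    "card ?B = length (filter (\<lambda>e. snd e = u) es)"
    using distinct_card[of "filter (\<lambda>e. fst e = u) es"] distinct_card[of "filter (\<lambda>e. snd e = u) es"]
      es(2) by simp_all
  ultimately show ?thesis by simp
qed

definition parent_map :: "nat \<Rightarrow> (nat \<Rightarrow> nat) \<Rightarrow> bool" where
  "parent_map r up \<longleftrightarrow> up r = r \<and>
     (\<forall>u<n. u \<noteq> r \<longrightarrow> (up u, u) \<in> parcs T \<and> tdist r u = Suc (tdist r (up u)))"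

definition prepared :: "nat \<Rightarrow> store \<Rightarrow> bool" where
  "prepared r s \<longleftrightarrow> holds_input s \<and> (\<forall>u<n. s ''h'' u + tdist r u = n) \<and>
     (\<forall>u<n. s ''deg'' u < 2 \<longleftrightarrow> u \<in> leaves T) \<and> parent_map r (s ''up'')"

definition degree_upto :: "nat \<Rightarrow> nat \<Rightarrow> nat" where
  "degree_upto j u = length (filter (\<lambda>e. fst e = u) (take j es)) +
     length (filter (\<lambda>e. snd e = u) (take j es))"

definition linked_upto :: "nat \<Rightarrow> nat \<Rightarrow> (nat \<Rightarrow> nat) \<Rightarrow> bool" where
  "linked_upto r j up \<longleftrightarrow> up r = r \<and>
     (\<forall>i<j. \<forall>u p. es ! i = (u, p) \<or> es ! i = (p, u) \<longrightarrow> tdist r u = Suc (tdist r p) \<longrightarrow> up u = p)"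

lemma linked_upto_Suc:
  assumes r: "r < n" and up: "linked_upto r j up" and j: "j < length es"
    and ab: "es ! j = (a, b) \<or> es ! j = (b, a)" "tdist r a = Suc (tdist r b)"
  shows "linked_upto r (Suc j) (up(a := b))"
proof -
  have rV: "r \<in> pverts T" using r pverts_T by simp
  have arcs: "(u, p) \<in> parcs T \<and> (p, u) \<in> parcs T"
    if "i < length es" "es ! i = (u, p) \<or> es ! i = (p, u)" for i u p
    using edge_arcs[OF that(1)] that(2) by auto
  have "a \<noteq> r" using ab(2) rV by auto
  moreover have "(up(a := b)) u = p"
    if i: "i < Suc j" and e: "es ! i = (u, p) \<or> es ! i = (p, u)" and d: "tdist r u = Suc (tdist r p)"
    for i u p
  proof (cases "u = a")
    case True
    have "i < length es" using i j by simp
    then have "(p, u) \<in> parcs T" "(b, a) \<in> parcs T"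
      using arcs[OF _ e] arcs[OF j ab(1)] by blast+
    with nearer_neighbor_unique[OF rV _ _ _ ab(2)] d have "p = b"
      unfolding True by blast
    with True show ?thesis by simp
  next
    case False
    have "i \<noteq> j"
    proof
      assume "i = j"
      then have "u = b" "p = a" using e ab(1) False by auto
      with d ab(2) show False by simp
    qed
    with i have "i < j" by simp
    with up e d have "up u = p"
      unfolding linked_upto_def by blast
    with False show ?thesis by simp
  qed
  ultimately show ?thesis
    using up unfolding linked_upto_def by auto
qed

lemma parent_map_linked:
  assumes r: "r < n" and up: "linked_upto r (length es) up"
  shows "parent_map r up"
  unfolding parent_map_def
proof (intro conjI allI impI)
  show "up r = r" using up by (simp add: linked_upto_def)
  fix u assume u: "u < n" "u \<noteq> r"
  have V: "r \<in> pverts T" "u \<in> pverts T" using r u pverts_T by auto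
  obtain p where p: "(p, u) \<in> parcs T" "tdist r u = Suc (tdist r p)"
    using ex_nearer_neighbor'[OF V] u(2) by auto
  obtain i where "i < length es" "es ! i = (u, p) \<or> es ! i = (p, u)"
    using arc_edge[OF p(1)] by blast
  then have "up u = p"
    using up p(2) unfolding linked_upto_def by blast
  then show "(up u, u) \<in> parcs T" "tdist r u = Suc (tdist r (up u))"
    using p by simp_all
qed

lemma eff_link_edge:
  fixes s :: store
  defines "a \<equiv> s ''src'' (s ''j'' 0)" and "b \<equiv> s ''dst'' (s ''j'' 0)"
  shows "eff link_edge s = s(''deg'' := (\<lambda>u. s ''deg'' u + (if u = a then 1 else 0) + (if u = b then 1 else 0)),
     ''up'' := (if s ''h'' a < s ''h'' b then (s ''up'')(a := b) else (s ''up'')(b := a)))"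
  by (rule ext) (simp add: link_edge_def update_def a_def b_def fun_eq_iff)

lemma runs_link:
  assumes r: "r < n" and inp: "holds_input s" and h: "\<And>u. u < n \<Longrightarrow> s ''h'' u + tdist r u = n"
    and deg: "\<And>u. s ''deg'' u = 0" and up: "s ''up'' r = r"
  shows "runs (For ''j'' (scalar ''m'') link_edge) s (link_cost n)
    (\<lambda>s'. prepared r s' \<and> (\<forall>x. x \<noteq> ''deg'' \<longrightarrow> x \<noteq> ''up'' \<longrightarrow> x \<noteq> ''j'' \<longrightarrow> s' x = s x))"
proof -
  define I where "I = (\<lambda>j s'. s' ''j'' 0 = j \<and> s' ''deg'' = degree_upto j \<and> linked_upto r j (s' ''up'') \<and>
    (\<forall>x. x \<noteq> ''deg'' \<longrightarrow> x \<noteq> ''up'' \<longrightarrow> x \<noteq> ''j'' \<longrightarrow> s' x = s x))"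
  have rV: "r \<in> pverts T" using r pverts_T by simp
  have "runs (For ''j'' (scalar ''m'') link_edge) s (link_cost n) (I (length es))"
  proof (rule runs_For[where b = "max_cost link_edge" and n' = "n * n"])
    show "I 0 (update s ''j'' 0 0)"
      using deg up by (simp add: I_def update_def degree_upto_def linked_upto_def fun_eq_iff)
    show "s' ''j'' 0 = j \<and> val s' (scalar ''m'') = length es" if "I j s'" "j \<le> length es" for j s'
      using that inp by (simp add: I_def holds_input_def)
    fix j s' assume I: "I j s'" and j: "j < length es"
    obtain a b where ab: "es ! j = (a, b)" by fastforce
    have src: "s' ''src'' j = a" "s' ''dst'' j = b" and sj: "s' ''j'' 0 = j"
      using I inp j ab by (simp_all add: I_def holds_input_def)
    have arc: "(a, b) \<in> parcs T" using edge_arcs(1)[OF j] ab by simp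
    have V: "a < n" "b < n" using arc pverts_T by (auto dest: wellformed')
    have "s' ''h'' = s ''h''" using I by (simp add: I_def)
    then have ha: "s' ''h'' a + tdist r a = n" "s' ''h'' b + tdist r b = n"
      using h V by simp_all
    let ?up = "if s' ''h'' a < s' ''h'' b then (s' ''up'')(a := b) else (s' ''up'')(b := a)"
    have up': "linked_upto r (Suc j) ?up"
      using arc_tdist_cases[OF rV arc]
    proof
      assume d: "tdist r b = Suc (tdist r a)"
      then have "\<not> s' ''h'' a < s' ''h'' b" using ha by linarith
      then show ?thesis
        using linked_upto_Suc[OF r _ j _ d] I ab by (simp add: I_def)
    next
      assume d: "tdist r a = Suc (tdist r b)"
      then have "s' ''h'' a < s' ''h'' b" using ha by linarith
      then show ?thesis
        using linked_upto_Suc[OF r _ j _ d] I ab by (simp add: I_def)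
    qed
    have deg': "degree_upto (Suc j) = (\<lambda>u. s' ''deg'' u + (if u = a then 1 else 0) + (if u = b then 1 else 0))"
      using I j ab by (simp add: I_def degree_upto_def take_Suc_conv_app_nth fun_eq_iff)
    have eff: "eff link_edge s' = s'(''deg'' := degree_upto (Suc j), ''up'' := ?up)"
      using eff_link_edge[of s'] by (simp only: sj src deg')
    have "loop_free link_edge" by (simp add: link_edge_def)
    then show "runs link_edge s' (max_cost link_edge)
        (\<lambda>s''. s'' ''j'' 0 = j \<and> I (Suc j) (update s'' ''j'' 0 (Suc j)))"
    proof (rule runs_loop_free)
      show "eff link_edge s' ''j'' 0 = j \<and> I (Suc j) (update (eff link_edge s') ''j'' 0 (Suc j))"
        unfolding eff using I up' sj by (simp add: I_def update_def)
    qed simp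
  qed (simp_all add: length_es link_cost_def)
  then show ?thesis
  proof (rule runs_mono)
    fix s' assume I: "I (length es) s'"
    then have deg': "s' ''deg'' = degree_upto (length es)" and up': "linked_upto r (length es) (s' ''up'')"
      and fr: "\<forall>x. x \<noteq> ''deg'' \<longrightarrow> x \<noteq> ''up'' \<longrightarrow> x \<noteq> ''j'' \<longrightarrow> s' x = s x"
      by (simp_all add: I_def)
    have "s' ''deg'' u = out_degree (with_proj T) u" for u
      unfolding deg' degree_upto_def out_degree_count by simp
    then have "\<forall>u<n. s' ''deg'' u < 2 \<longleftrightarrow> u \<in> leaves T"
      by (auto simp: leaves_def pverts_T)
    moreover have "holds_input s'"
      using inp fr by (simp add: holds_input_def)
    moreover have "s' ''h'' = s ''h''"
      using fr by simp
    ultimately have "prepared r s'"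
      using h parent_map_linked[OF r up'] unfolding prepared_def by simp
    then show "prepared r s' \<and> (\<forall>x. x \<noteq> ''deg'' \<longrightarrow> x \<noteq> ''up'' \<longrightarrow> x \<noteq> ''j'' \<longrightarrow> s' x = s x)"
      using fr by blast
  qed simp
qed

lemma runs_heights:
  assumes r: "r < n" and inp: "holds_input s" and h: "s ''h'' = (\<lambda>_. 0)(r := n)"
  shows "runs (relax ''h'') s (relax_cost n)
    (\<lambda>s'. (\<forall>u<n. s' ''h'' u + tdist r u = n) \<and>
       (\<forall>x. x \<noteq> ''h'' \<longrightarrow> x \<noteq> ''j'' \<longrightarrow> x \<noteq> ''i'' \<longrightarrow> s' x = s x))"
proof -
  have rV: "r \<in> pverts T" using r pverts_T by simp
  have "reach_sound {r} n (s ''h'')" "\<And>c. c \<in> {r} \<Longrightarrow> n \<le> s ''h'' c"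
    using rV by (auto simp: reach_sound_def h)
  then have relaxed: "runs (relax ''h'') s (relax_cost n)
    (\<lambda>s'. reach_sound {r} n (s' ''h'') \<and> reach_complete {r} n n (s' ''h'') \<and>
       (\<forall>x. x \<noteq> ''h'' \<longrightarrow> x \<noteq> ''j'' \<longrightarrow> x \<noteq> ''i'' \<longrightarrow> s' x = s x))"
    using r inp by (intro runs_relax) auto
  have "f u + tdist r u = n"
    if f: "reach_sound {r} n f" "reach_complete {r} n n f" and u: "u < n" for f u
  proof -
    have d: "tdist r u < n" by (rule tdist_le_n[OF r u])
    then have "n \<le> f u + tdist r u"
      using f(2) u by (simp add: reach_complete_def)
    moreover have "f u = 0 \<or> f u + tdist r u \<le> n"
      using f(1) u by (simp add: reach_sound_def)
    ultimately show ?thesis using d by linarith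
  qed
  note exact = this
  show ?thesis
    by (rule runs_mono[OF relaxed order_refl]) (use exact in blast)
qed

definition guards :: "nat list \<Rightarrow> (nat \<Rightarrow> nat) \<Rightarrow> bool" where
  "guards cs g \<longleftrightarrow> set cs \<subseteq> {..<n} \<and> reach_sound (set cs) 3 g \<and> reach_complete (set cs) 3 n g"

lemma guards_iff:
  assumes "guards cs g" "u < n"
  shows "g u < 1 \<longleftrightarrow> \<not> (\<exists>c \<in> set cs. tdist c u \<le> 2)"
proof
  assume 0: "g u < 1"
  show "\<not> (\<exists>c \<in> set cs. tdist c u \<le> 2)"
  proof
    assume "\<exists>c \<in> set cs. tdist c u \<le> 2"
    then obtain c where c: "c \<in> set cs" "tdist c u \<le> 2" by blast
    then have "tdist c u \<le> n"
      using tdist_le_n[of c u] assms by (auto simp: guards_def)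
    then have "3 \<le> g u + tdist c u"
      using assms c(1) by (simp add: guards_def reach_complete_def)
    with 0 c(2) show False by simp
  qed
next
  assume far: "\<not> (\<exists>c \<in> set cs. tdist c u \<le> 2)"
  show "g u < 1"
  proof (rule ccontr)
    assume "\<not> g u < 1"
    then obtain c where "c \<in> set cs" "g u + tdist c u \<le> 3"
      using assms unfolding guards_def reach_sound_def by auto
    with \<open>\<not> g u < 1\<close> far show False by force
  qed
qed

definition farthest :: "nat \<Rightarrow> nat list \<Rightarrow> store \<Rightarrow> bool" where
  "farthest r cs s \<longleftrightarrow> (if s ''key'' 0 = 0 then unguarded_leaves T cs = {}
     else s ''best'' 0 \<in> unguarded_leaves T cs \<and>
       (\<forall>u \<in> unguarded_leaves T cs. tdist u r \<le> tdist (s ''best'' 0) r))"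

lemma eff_inspect_vertex:
  fixes s :: store
  defines "j \<equiv> s ''j'' 0"
  shows "eff inspect_vertex s =
    (if s ''deg'' j < 2 \<and> s ''g'' j < 1 \<and> s ''key'' 0 < s ''n'' 0 + 1 - s ''h'' j
     then s(''key'' := (s ''key'')(0 := s ''n'' 0 + 1 - s ''h'' j), ''best'' := (s ''best'')(0 := j))
     else s)"
  by (simp add: inspect_vertex_def update_def j_def)

lemma runs_scan:
  assumes r: "r < n" and prep: "prepared r s" and g: "guards cs (s ''g'')" and key: "s ''key'' 0 = 0"
  shows "runs (For ''j'' (scalar ''n'') inspect_vertex) s (scan_cost n)
    (\<lambda>s'. farthest r cs s' \<and> (\<forall>x. x \<noteq> ''j'' \<longrightarrow> x \<noteq> ''key'' \<longrightarrow> x \<noteq> ''best'' \<longrightarrow> s' x = s x))"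
proof -
  let ?U = "unguarded_leaves T cs"
  define I where "I = (\<lambda>j s'. s' ''j'' 0 = j \<and>
    (if s' ''key'' 0 = 0 then \<forall>u \<in> ?U. \<not> u < j
     else s' ''best'' 0 \<in> ?U \<and> s' ''key'' 0 = Suc (tdist r (s' ''best'' 0)) \<and>
       (\<forall>u \<in> ?U. u < j \<longrightarrow> tdist r u \<le> tdist r (s' ''best'' 0))) \<and>
    (\<forall>x. x \<noteq> ''j'' \<longrightarrow> x \<noteq> ''key'' \<longrightarrow> x \<noteq> ''best'' \<longrightarrow> s' x = s x))"
  have rV: "r \<in> pverts T" using r pverts_T by simp
  have "runs (For ''j'' (scalar ''n'') inspect_vertex) s (scan_cost n) (I n)"
  proof (rule runs_For[where b = "max_cost inspect_vertex" and n' = n])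
    show "I 0 (update s ''j'' 0 0)"
      using key by (simp add: I_def update_def)
    show "s' ''j'' 0 = j \<and> val s' (scalar ''n'') = n" if "I j s'" "j \<le> n" for j s'
      using that prep by (simp add: I_def prepared_def holds_input_def)
    fix j s' assume I: "I j s'" and j: "j < n"
    have sj: "s' ''j'' 0 = j" and fr: "s' ''deg'' = s ''deg''" "s' ''g'' = s ''g''" "s' ''h'' = s ''h''"
        "s' ''n'' = s ''n''"
      using I by (simp_all add: I_def)
    have U: "s' ''deg'' j < 2 \<and> s' ''g'' j < 1 \<longleftrightarrow> j \<in> ?U"
      using prep guards_iff[OF g j] j by (simp add: fr prepared_def unguarded_leaves_def)
    have "s ''h'' j + tdist r j = n" "s ''n'' 0 = n"
      using prep j by (simp_all add: prepared_def holds_input_def)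
    then have key': "s' ''n'' 0 + 1 - s' ''h'' j = Suc (tdist r j)"
      by (simp add: fr)
    have eff: "eff inspect_vertex s' =
      (if j \<in> ?U \<and> s' ''key'' 0 < Suc (tdist r j)
       then s'(''key'' := (s' ''key'')(0 := Suc (tdist r j)), ''best'' := (s' ''best'')(0 := j)) else s')"
      unfolding eff_inspect_vertex sj key' using U by auto
    have "loop_free inspect_vertex" by (simp add: inspect_vertex_def)
    then show "runs inspect_vertex s' (max_cost inspect_vertex)
        (\<lambda>s''. s'' ''j'' 0 = j \<and> I (Suc j) (update s'' ''j'' 0 (Suc j)))"
    proof (rule runs_loop_free)
      show "eff inspect_vertex s' ''j'' 0 = j \<and> I (Suc j) (update (eff inspect_vertex s') ''j'' 0 (Suc j))"
      proof (cases "j \<in> ?U \<and> s' ''key'' 0 < Suc (tdist r j)")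
        case True
        have "tdist r u \<le> tdist r j" if "u \<in> ?U" "u < Suc j" for u
          using True that I unfolding I_def by (cases "u = j") (force split: if_splits)+
        then show ?thesis
          using True I sj unfolding eff by (simp add: I_def update_def)
      next
        case False
        then have "eff inspect_vertex s' = s'" unfolding eff by (rule if_not_P)
        moreover have "u < Suc j \<longleftrightarrow> u < j \<or> u = j" for u by auto
        ultimately show ?thesis
          using False I sj unfolding I_def update_def by (auto split: if_splits)
      qed
    qed simp
  qed (simp_all add: scan_cost_def)
  then show ?thesis
  proof (rule runs_mono)
    fix s' assume I: "I n s'"
    have lt: "u < n" if "u \<in> ?U" for u
      using that unguarded_leaves_verts pverts_T by blast
    have comm: "tdist u r = tdist r u" if "u \<in> ?U" for u
      using tdist_commute[OF _ rV] that unguarded_leaves_verts by blast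
    show "farthest r cs s' \<and> (\<forall>x. x \<noteq> ''j'' \<longrightarrow> x \<noteq> ''key'' \<longrightarrow> x \<noteq> ''best'' \<longrightarrow> s' x = s x)"
      using I lt comm unfolding I_def farthest_def by (auto split: if_splits)
  qed simp
qed

definition placed :: "nat \<Rightarrow> nat \<Rightarrow> store \<Rightarrow> bool" where
  "placed r k s \<longleftrightarrow> prepared r s \<and> guards (output_cops s) (s ''g'') \<and>
     (placement_step T r)\<^sup>*\<^sup>* [] (output_cops s) \<and>
     card (unguarded_leaves T (output_cops s)) \<le> n - k"

lemma eff_put_cop:
  fixes s :: store
  defines "c \<equiv> s ''up'' (s ''up'' (s ''best'' 0))"
  shows "eff put_cop s = (if 0 < s ''key'' 0 then s(''cop'' := (s ''cop'')(s ''count'' 0 := c),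
    ''g'' := (s ''g'')(c := 3), ''count'' := (s ''count'')(0 := Suc (s ''count'' 0))) else s)"
  by (simp add: put_cop_def update_def c_def)

lemma reach_start:
  assumes "guards cs g" "c < n"
  shows "reach_sound (set (cs @ [c])) 3 (g(c := 3))" "d \<in> set (cs @ [c]) \<Longrightarrow> 3 \<le> (g(c := 3)) d"
proof -
  have "tdist c c = 0" using assms(2) pverts_T by simp
  then show "reach_sound (set (cs @ [c])) 3 (g(c := 3))"
    using assms unfolding guards_def reach_sound_def by auto
  have "3 \<le> g e" if e: "e \<in> set cs" for e
  proof -
    have "e < n" using e assms(1) by (auto simp: guards_def)
    moreover from this have "tdist e e = 0" using pverts_T by simp
    ultimately show ?thesis
      using assms(1) e unfolding guards_def reach_complete_def by force
  qed
  then show "d \<in> set (cs @ [c]) \<Longrightarrow> 3 \<le> (g(c := 3)) d" by auto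
qed

lemma put_cop_step:
  assumes r: "r < n" and prep: "prepared r s" and g: "guards (output_cops s) (s ''g'')"
    and far: "farthest r (output_cops s) s"
  defines "s' \<equiv> eff put_cop s"
  shows "prepared r s'"
    "s' ''k'' = s ''k''"
    "set (output_cops s') \<subseteq> {..<n}"
    "reach_sound (set (output_cops s')) 3 (s' ''g'')"
    "\<And>c. c \<in> set (output_cops s') \<Longrightarrow> 3 \<le> s' ''g'' c"
    "unguarded_leaves T (output_cops s) = {} \<and> output_cops s' = output_cops s \<or>
      placement_step T r (output_cops s) (output_cops s')"
proof -
  let ?cs = "output_cops s"
  define v where "v = s ''best'' 0"
  define c where "c = s ''up'' (s ''up'' v)"
  have rV: "r \<in> pverts T" using r pverts_T by simp
  show "prepared r s'"
    using prep by (simp add: s'_def eff_put_cop prepared_def holds_input_def)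
  show "s' ''k'' = s ''k''"
    by (simp add: s'_def eff_put_cop)
  have "set (output_cops s') \<subseteq> {..<n} \<and> reach_sound (set (output_cops s')) 3 (s' ''g'') \<and>
    (\<forall>c \<in> set (output_cops s'). 3 \<le> s' ''g'' c) \<and>
    (unguarded_leaves T ?cs = {} \<and> output_cops s' = ?cs \<or> placement_step T r ?cs (output_cops s'))"
  proof (cases "s ''key'' 0 = 0")
    case True
    then have "s' = s" by (simp add: s'_def eff_put_cop)
    moreover have "3 \<le> s ''g'' e" if "e \<in> set ?cs" for e
    proof -
      have "e < n" using that g by (auto simp: guards_def)
      then show ?thesis using reach_start(2)[OF g, of e e] that g pverts_T
        unfolding guards_def reach_complete_def by force
    qed
    moreover have "unguarded_leaves T ?cs = {}"
      using far True by (simp add: farthest_def)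
    ultimately show ?thesis using g by (simp add: guards_def)
  next
    case False
    then have v: "v \<in> unguarded_leaves T ?cs" "\<forall>u \<in> unguarded_leaves T ?cs. tdist u r \<le> tdist v r"
      using far by (simp_all add: farthest_def v_def)
    have vV: "v \<in> pverts T" using v(1) unguarded_leaves_verts by blast
    have site: "cop_site T r v c"
      unfolding c_def
      by (rule cop_site_iterated_parent[OF rV vV])
        (use prep pverts_T in \<open>auto simp: prepared_def parent_map_def\<close>)
    have cn: "c < n" using cop_site_cases(1)[OF rV vV site] pverts_T by simp
    have s': "s' = s(''cop'' := (s ''cop'')(s ''count'' 0 := c), ''g'' := (s ''g'')(c := 3),
        ''count'' := (s ''count'')(0 := Suc (s ''count'' 0)))"
      using False by (simp add: s'_def eff_put_cop c_def v_def)
    have cs': "output_cops s' = ?cs @ [c]"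
      by (simp add: s' output_cops_def)
    have "placement_step T r ?cs (?cs @ [c])"
      using v site unfolding placement_step_def by blast
    moreover have "s' ''g'' = (s ''g'')(c := 3)" by (simp add: s')
    moreover have "set (?cs @ [c]) \<subseteq> {..<n}" using g cn by (simp add: guards_def)
    ultimately show ?thesis
      using reach_start[OF g cn] unfolding cs' by simp
  qed
  then show "set (output_cops s') \<subseteq> {..<n}"
    "reach_sound (set (output_cops s')) 3 (s' ''g'')"
    "\<And>c. c \<in> set (output_cops s') \<Longrightarrow> 3 \<le> s' ''g'' c"
    "unguarded_leaves T ?cs = {} \<and> output_cops s' = ?cs \<or> placement_step T r ?cs (output_cops s')"
    by blast+
qed

lemma runs_place_cop:
  assumes r: "r < n" and pl: "placed r k s" and k: "k < n"
  shows "runs place_cop s (place_cost n) (\<lambda>s'. s' ''k'' = s ''k'' \<and> placed r (Suc k) s')"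
proof -
  let ?cs = "output_cops s"
  let ?Q = "\<lambda>s'. s' ''k'' = s ''k'' \<and> placed r (Suc k) s'"
  have prep: "prepared r s" and g: "guards ?cs (s ''g'')"
    and run: "(placement_step T r)\<^sup>*\<^sup>* [] ?cs" and left: "card (unguarded_leaves T ?cs) \<le> n - k"
    using pl by (simp_all add: placed_def)
  have rV: "r \<in> pverts T" using r pverts_T by simp
  have last: "runs (relax ''g'') s2 (relax_cost n) ?Q"
    if s1: "farthest r ?cs s1" "\<forall>x. x \<noteq> ''j'' \<longrightarrow> x \<noteq> ''key'' \<longrightarrow> x \<noteq> ''best'' \<longrightarrow> s1 x = s x"
      and s2: "s2 = eff put_cop s1" for s1 s2
  proof -
    have out1: "output_cops s1 = ?cs"
      using s1(2) by (simp add: output_cops_def)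
    have "prepared r s1"
      using prep s1(2) by (simp add: prepared_def holds_input_def)
    moreover have "guards (output_cops s1) (s1 ''g'')" "farthest r (output_cops s1) s1"
      using g s1 by (simp_all add: out1)
    ultimately have prem: "prepared r s1" "guards (output_cops s1) (s1 ''g'')"
      "farthest r (output_cops s1) s1" .
    note p = put_cop_step[OF r prem, folded s2, unfolded out1]
    have run2: "(placement_step T r)\<^sup>*\<^sup>* [] (output_cops s2)"
      using p(6) run by (auto intro: rtranclp.rtrancl_into_rtrancl)
    have left2: "card (unguarded_leaves T (output_cops s2)) \<le> n - Suc k"
      using p(6)
    proof
      assume "placement_step T r ?cs (output_cops s2)"
      then have "card (unguarded_leaves T (output_cops s2)) < card (unguarded_leaves T ?cs)"
        by (rule psubset_card_mono[OF finite_unguarded_leaves placement_step_decreases[OF rV]])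
      then show ?thesis using left by linarith
    qed simp
    have "holds_input s2" using p(1) by (simp add: prepared_def)
    then have "runs (relax ''g'') s2 (relax_cost n)
      (\<lambda>s'. reach_sound (set (output_cops s2)) 3 (s' ''g'') \<and>
        reach_complete (set (output_cops s2)) 3 n (s' ''g'') \<and>
        (\<forall>x. x \<noteq> ''g'' \<longrightarrow> x \<noteq> ''j'' \<longrightarrow> x \<noteq> ''i'' \<longrightarrow> s' x = s2 x))"
      by (rule runs_relax[where s = s2 and A = "''g''" and w = 3, OF p(3) _ _ p(4,5)]) auto
    then show ?thesis
    proof (rule runs_mono)
      fix s' assume s': "reach_sound (set (output_cops s2)) 3 (s' ''g'') \<and>
        reach_complete (set (output_cops s2)) 3 n (s' ''g'') \<and>
        (\<forall>x. x \<noteq> ''g'' \<longrightarrow> x \<noteq> ''j'' \<longrightarrow> x \<noteq> ''i'' \<longrightarrow> s' x = s2 x)"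
      then have out: "output_cops s' = output_cops s2" by (simp add: output_cops_def)
      have "prepared r s'"
        using p(1) s' by (simp add: prepared_def holds_input_def)
      then show "?Q s'"
        using s' p(2,3) s1(2) run2 left2 by (simp add: placed_def guards_def out)
    qed simp
  qed
  have put: "runs put_cop s1 (max_cost put_cop) (\<lambda>s2. runs (relax ''g'') s2 (relax_cost n) ?Q)"
    if "farthest r ?cs s1 \<and> (\<forall>x. x \<noteq> ''j'' \<longrightarrow> x \<noteq> ''key'' \<longrightarrow> x \<noteq> ''best'' \<longrightarrow> s1 x = s x)" for s1
  proof (rule runs_loop_free)
    show "loop_free put_cop" by (simp add: put_cop_def)
    show "runs (relax ''g'') (eff put_cop s1) (relax_cost n) ?Q"
      using that by (intro last[of s1]) auto
  qed simp
  define s0 where "s0 = update s ''key'' (val s (Num 0)) (val s (Num 0))"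
  have s0: "s0 ''key'' 0 = 0" and s0_frame: "x \<noteq> ''key'' \<Longrightarrow> s0 x = s x" for x
    by (simp_all add: s0_def update_def)
  have "prepared r s0" "guards ?cs (s0 ''g'')"
    using prep g by (simp_all add: s0_frame prepared_def holds_input_def)
  then have scan: "runs (For ''j'' (scalar ''n'') inspect_vertex) s0 (scan_cost n)
    (\<lambda>s1. farthest r ?cs s1 \<and> (\<forall>x. x \<noteq> ''j'' \<longrightarrow> x \<noteq> ''key'' \<longrightarrow> x \<noteq> ''best'' \<longrightarrow> s1 x = s0 x))"
    by (rule runs_scan[OF r]) (rule s0)
  have rest: "runs (Seq put_cop (relax ''g'')) s1 (max_cost put_cop + relax_cost n + 1) ?Q"
    if "farthest r ?cs s1 \<and> (\<forall>x. x \<noteq> ''j'' \<longrightarrow> x \<noteq> ''key'' \<longrightarrow> x \<noteq> ''best'' \<longrightarrow> s1 x = s0 x)" for s1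
    by (rule runs_Seq[OF put]) (use that s0_frame in auto)
  have all: "runs (Seq (For ''j'' (scalar ''n'') inspect_vertex) (Seq put_cop (relax ''g''))) s0
      (scan_cost n + (max_cost put_cop + relax_cost n + 1) + 1) ?Q"
    by (rule runs_Seq[OF runs_mono[OF scan order_refl rest] order_refl])
  show ?thesis
    unfolding place_cop_def place_cost_def by (rule runs_Assign_Seq[OF all[unfolded s0_def]]) simp
qed

lemma runs_main:
  assumes r: "r < n" and pl: "placed r 0 s"
  shows "runs (For ''k'' (scalar ''n'') place_cop) s (main_cost n)
    (\<lambda>s'. placement_result T r (output_cops s'))"
proof -
  have upd: "placed r k (update s' ''k'' 0 i) = placed r k s'" for k s' i
    by (simp add: placed_def prepared_def holds_input_def output_cops_def update_def)
  have "runs (For ''k'' (scalar ''n'') place_cop) s (main_cost n)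
    (\<lambda>s'. s' ''k'' 0 = n \<and> placed r n s')"
  proof (rule runs_For[where b = "place_cost n" and n' = n and I = "\<lambda>k s'. s' ''k'' 0 = k \<and> placed r k s'"])
    show "update s ''k'' 0 0 ''k'' 0 = 0 \<and> placed r 0 (update s ''k'' 0 0)"
      using pl by (simp add: upd) (simp add: update_def)
    show "s' ''k'' 0 = k \<and> val s' (scalar ''n'') = n" if "s' ''k'' 0 = k \<and> placed r k s'" for k s'
      using that by (simp add: placed_def prepared_def holds_input_def)
    fix k s' assume s': "s' ''k'' 0 = k \<and> placed r k s'" and k: "k < n"
    then have "runs place_cop s' (place_cost n) (\<lambda>s''. s'' ''k'' = s' ''k'' \<and> placed r (Suc k) s'')"
      by (intro runs_place_cop[OF r]) auto
    then show "runs place_cop s' (place_cost n) (\<lambda>s''. s'' ''k'' 0 = k \<and>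
        update s'' ''k'' 0 (Suc k) ''k'' 0 = Suc k \<and> placed r (Suc k) (update s'' ''k'' 0 (Suc k)))"
      by (rule runs_mono) (use s' in \<open>simp_all add: upd\<close>, simp add: update_def)
  qed (simp_all add: main_cost_def)
  then show ?thesis
    by (rule runs_mono)
      (use finite_unguarded_leaves in \<open>auto simp: placed_def placement_result_def\<close>)
qed

lemma runs_placement_prog:
  assumes r: "r < n"
  shows "runs placement_prog (input_store n es r) (total_cost n)
    (\<lambda>s'. placement_result T r (output_cops s'))"
proof -
  let ?Q = "\<lambda>s'. placement_result T r (output_cops s')"
  define s where "s = input_store n es r"
  define s0 where "s0 = update s ''h'' r n"
  have inp: "holds_input s0"
    by (simp add: holds_input_def s0_def s_def update_def input_store_def)
  have zero: "s0 ''up'' u = 0" "s0 ''deg'' u = 0" "s0 ''g'' u = 0" "s0 ''count'' u = 0"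
    and root: "s0 ''root'' 0 = r" and h: "s0 ''h'' = (\<lambda>_. 0)(r := n)" for u
    by (simp_all add: s0_def s_def update_def input_store_def fun_eq_iff)
  note heights = runs_heights[OF r inp h]
  have loops: "runs (Seq (For ''j'' (scalar ''m'') link_edge) (For ''k'' (scalar ''n'') place_cop))
      (update s1 ''up'' r r) (link_cost n + main_cost n + 1) ?Q"
    if s1: "\<forall>u<n. s1 ''h'' u + tdist r u = n"
      "\<forall>x. x \<noteq> ''h'' \<longrightarrow> x \<noteq> ''j'' \<longrightarrow> x \<noteq> ''i'' \<longrightarrow> s1 x = s0 x" for s1
  proof -
    define s2 where "s2 = update s1 ''up'' r r"
    have fr: "s2 x = s0 x" if "x \<notin> {''h'', ''j'', ''i'', ''up''}" for x
      using that s1(2) by (simp add: s2_def update_def)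
    have "holds_input s2" using inp by (simp add: holds_input_def fr)
    moreover have "s2 ''h'' u + tdist r u = n" if "u < n" for u
      using s1(1) that by (simp add: s2_def update_def)
    moreover have "s2 ''deg'' u = 0" for u by (simp add: fr zero)
    moreover have "s2 ''up'' r = r" by (simp add: s2_def update_def)
    ultimately have link: "runs (For ''j'' (scalar ''m'') link_edge) s2 (link_cost n)
      (\<lambda>s'. prepared r s' \<and> (\<forall>x. x \<noteq> ''deg'' \<longrightarrow> x \<noteq> ''up'' \<longrightarrow> x \<noteq> ''j'' \<longrightarrow> s' x = s2 x))"
      by (rule runs_link[OF r])
    have "runs (For ''k'' (scalar ''n'') place_cop) s3 (main_cost n) ?Q"
      if s3: "prepared r s3 \<and> (\<forall>x. x \<noteq> ''deg'' \<longrightarrow> x \<noteq> ''up'' \<longrightarrow> x \<noteq> ''j'' \<longrightarrow> s3 x = s2 x)" for s3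
    proof (rule runs_main[OF r])
      have "s3 ''count'' 0 = 0" "\<And>u. s3 ''g'' u = 0"
        using s3 by (simp_all add: fr zero)
      then have "output_cops s3 = []" "guards [] (s3 ''g'')"
        by (simp_all add: output_cops_def guards_def reach_sound_def reach_complete_def)
      moreover have "card (unguarded_leaves T []) \<le> n"
        using card_mono[OF _ unguarded_leaves_verts[of "[]"]] pverts_T by simp
      ultimately show "placed r 0 s3"
        using s3 by (simp add: placed_def)
    qed
    then show ?thesis
      unfolding s2_def[symmetric] by (intro runs_Seq[OF runs_mono[OF link order_refl] order_refl])
  qed
  have up: "runs (Seq (Assign ''up'' (scalar ''root'') (scalar ''root''))
      (Seq (For ''j'' (scalar ''m'') link_edge) (For ''k'' (scalar ''n'') place_cop))) s1
      (5 + (link_cost n + main_cost n + 1) + 1) ?Q"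
    if s1: "(\<forall>u<n. s1 ''h'' u + tdist r u = n) \<and>
      (\<forall>x. x \<noteq> ''h'' \<longrightarrow> x \<noteq> ''j'' \<longrightarrow> x \<noteq> ''i'' \<longrightarrow> s1 x = s0 x)" for s1
  proof (rule runs_Assign_Seq)
    have "s1 ''root'' 0 = r" using s1 root by simp
    then show "runs (Seq (For ''j'' (scalar ''m'') link_edge) (For ''k'' (scalar ''n'') place_cop))
        (update s1 ''up'' (val s1 (scalar ''root'')) (val s1 (scalar ''root'')))
        (link_cost n + main_cost n + 1) ?Q"
      using loops[of s1] s1 by simp
  qed simp
  have s0_val: "s0 = update s ''h'' (val s (scalar ''root'')) (val s (scalar ''n''))"
    by (simp add: s0_def s_def input_store_def)
  have all: "runs (Seq (relax ''h'') (Seq (Assign ''up'' (scalar ''root'') (scalar ''root''))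
      (Seq (For ''j'' (scalar ''m'') link_edge) (For ''k'' (scalar ''n'') place_cop)))) s0
      (relax_cost n + (5 + (link_cost n + main_cost n + 1) + 1) + 1) ?Q"
    by (rule runs_Seq[OF runs_mono[OF heights order_refl up] order_refl])
  show ?thesis
    unfolding placement_prog_def total_cost_def s_def[symmetric]
    by (rule runs_Assign_Seq[OF all[unfolded s0_val]]) simp
qed

end

theorem theorem3p1:
  shows
    "(\<forall>T :: 'a pair_pre_digraph. finite_tree T \<longrightarrow>
        (\<forall>r \<in> pverts T.
           (\<nexists>run. run 0 = [] \<and> (\<forall>i. placement_step T r (run i) (run (Suc i)))) \<and>
           (\<exists>cs. placement_result T r cs) \<and>
           (\<forall>cs. placement_result T r cs \<longrightarrow> bridge_burning_cop_number T = length cs)))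
     \<and>
     (\<exists>(P :: prog) (q :: nat poly).
        \<forall>n es (T :: nat pair_pre_digraph). finite_tree T \<and> represents n es T \<longrightarrow>
        (\<forall>r \<in> pverts T.
           \<exists>t s. exec P (input_store n es r) t s \<and> t \<le> poly q (card (pverts T)) \<and>
                 placement_result T r (output_cops s)))"
proof (intro conjI allI impI ballI)
  fix T :: "'a pair_pre_digraph" and r
  assume "finite_tree T" and r: "r \<in> pverts T"
  then interpret undirected_tree T by unfold_locales
  show "\<nexists>run. run 0 = [] \<and> (\<forall>i. placement_step T r (run i) (run (Suc i)))"
    by (rule no_infinite_placement[OF r])
  show "\<exists>cs. placement_result T r cs"
    by (rule placement_terminates[OF r])
  show "bridge_burning_cop_number T = length cs" if "placement_result T r cs" for cs
    by (rule cop_number_placement[OF r that])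
next
  obtain q where q: "\<And>N. total_cost N = poly q N"
    using polynomially_bounded_total_cost unfolding polynomially_bounded_def by blast
  have "\<exists>t s. exec placement_prog (input_store n es r) t s \<and> t \<le> poly q (card (pverts T)) \<and>
      placement_result T r (output_cops s)"
    if T: "finite_tree T \<and> represents n es T" and r: "r \<in> pverts T"
    for n es r and T :: "nat pair_pre_digraph"
  proof -
    interpret tree_input T n es
      using T by unfold_locales simp_all
    have "r < n" "card (pverts T) = n"
      using r pverts_T by simp_all
    then show ?thesis
      using runs_placement_prog[of r] q[of n] unfolding runs_def by simp
  qed
  then show "\<exists>(P :: prog) (q :: nat poly).
        \<forall>n es (T :: nat pair_pre_digraph). finite_tree T \<and> represents n es T \<longrightarrow>
        (\<forall>r \<in> pverts T.
           \<exists>t s. exec P (input_store n es r) t s \<and> t \<le> poly q (card (pverts T)) \<and>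
                 placement_result T r (output_cops s))"
    by blast
qed

end
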